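(* Let $a\in\mathbb{R}$, $\mu_1>0$, $\mu_2<0$, $\sigma_1,\sigma_2>0$, and let $p(t;x,z)$ be the transition density of the unique strong solution $X$ of $$\mathrm{d} X_t=(\mu_1 \mathbf{1}_{\{X_t \le a\}}+\mu_2 \mathbf{1}_{\{X_t> a\}})\,\mathrm{d} t+(\sigma_1\mathbf{1}_{\{X_t\le a\}}+\sigma_2\mathbf{1}_{\{X_t> a\}})\,\mathrm{d} B_t .$$ Then for every $x\in\mathbb{R}$, $$\lim_{t\to \infty}p(t;x,z)= \begin{cases} \dfrac{-\mu_1\mu_2}{\mu_1-\mu_2}\, \dfrac{2}{\sigma_2^2}\,e^{\frac{2\mu_2 (z-a)}{\sigma_2^2}}, & z\ge a,\\[2ex] \dfrac{-\mu_1\mu_2}{\mu_1-\mu_2}\, \dfrac{2}{\sigma_1^2}\,e^{\frac{2\mu_1 (z-a)}{\sigma_1^2}}, & z< a. \end{cases}$$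
   Context: $B$ is a standard one-dimensional Brownian motion; the stochastic differential equation is known to have a unique strong solution. The function $h$ is $h(t ; x, \mu):=\frac{|x|}{\sqrt{2 \pi t^3}} \exp [-\frac{(x+\mu t)^2}{2 t}]$ for $t>0$, $x,\mu\in\mathbb{R}$. The transition density $p(t;x,z)$ (density in $z$ of the law of $X_t$ given $X_0=x$) is understood as the following version, right-continuous in $z$ at $z=a$. For $x\ge a$, $z\ge a$: $$\begin{aligned}p(t;x,z)=\;&\frac{2}{\sigma_2^2} \int_0^{\infty}\!\! \int_0^{t} e^{\frac{2\mu_2(z-a)}{\sigma_2^2}}e^{\frac{2\mu_1b}{\sigma_1^2}}\, h\!\left(t-\tau ; \tfrac{b}{\sigma_1}, \tfrac{\mu_1}{\sigma_1}\right) h\!\left(\tau ;\tfrac{z+x-2a+b}{\sigma_2},\tfrac{ \mu_2}{\sigma_2}\right) \mathrm{d} \tau\, \mathrm{d} b\\ &+\frac{1}{\sqrt{2 \pi t\sigma_2^2}} \left[\exp \left(-\frac{(z-x-\mu_2t)^2}{2 t\sigma_2^2}\right)-\exp \left(-\frac{(z+x-2a-\mu_2t)^2}{2t\sigma_2^2}-\frac{2 \mu_2(x-a)}{\sigma_2^2}\right)\right].\end{aligned}$$ For $x\ge a$, $z<a$: $$p(t;x,z)=\frac{2}{\sigma_1^2} \int_0^{\infty}\!\! \int_0^{t} e^{\frac{2\mu_1b}{\sigma_1^2}}\, h\!\left(t-\tau ; \tfrac{b-z+a}{\sigma_1}, \tfrac{\mu_1}{\sigma_1}\right) h\!\left(\tau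 ;\tfrac{x-a+b}{\sigma_2},\tfrac{ \mu_2}{\sigma_2}\right) \mathrm{d} \tau\, \mathrm{d} b.$$ For $x<a$, $z<a$: $$\begin{aligned}p(t;x,z)=\;&\frac{2}{\sigma_1^2} \int_{-\infty}^{0}\! \int_0^{t} e^{\frac{2\mu_1(z-a)}{\sigma_1^2}} e^{\frac{2\mu_2b}{\sigma_2^2}}\, h\!\left(t-\tau ; \tfrac{b}{\sigma_2}, \tfrac{\mu_2}{\sigma_2}\right) h\!\left(\tau ;\tfrac{z+x-2a+b}{\sigma_1},\tfrac{ \mu_1}{\sigma_1}\right) \mathrm{d} \tau\, \mathrm{d} b\\ &+\frac{1}{\sqrt{2 \pi t\sigma_1^2}} \left[\exp \left(-\frac{(z-x-\mu_1t)^2}{2 t\sigma_1^2}\right)-\exp \left(-\frac{(z+x-2a-\mu_1t)^2}{2t\sigma_1^2}-\frac{2 \mu_1(x-a)}{\sigma_1^2}\right)\right].\end{aligned}$$ For $x<a$, $z\ge a$: $$p(t;x,z)=\frac{2}{\sigma_2^2} \int_{-\infty}^{0}\! \int_0^{t} e^{\frac{2\mu_2b}{\sigma_2^2}}\, h\!\left(t-\tau ; \tfrac{b-z+a}{\sigma_2}, \tfrac{\mu_2}{\sigma_2}\right) h\!\left(\tau ;\tfrac{x-a+b}{\sigma_1},\tfrac{ \mu_1}{\sigma_1}\right) \mathrm{d} \tau\, \mathrm{d} b.$$ *)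

theory Defs
  imports "HOL-Probability.Probability"
begin

definition brownian_motion :: "'w measure \<Rightarrow> (real \<Rightarrow> 'w \<Rightarrow> real) \<Rightarrow> bool" where
  "brownian_motion M B \<longleftrightarrow>
     (\<forall>t\<ge>0. B t \<in> borel_measurable M) \<and>
     (\<forall>\<omega>\<in>space M. continuous_on {0..} (\<lambda>t. B t \<omega>)) \<and>
     (AE \<omega> in M. B 0 \<omega> = 0) \<and>
     (\<forall>s t. 0 \<le> s \<and> s < t \<longrightarrow>
        distributed M lborel (\<lambda>\<omega>. B t \<omega> - B s \<omega>)
          (\<lambda>y. ennreal (normal_density 0 (sqrt (t - s)) y))) \<and>
     (\<forall>(n::nat) \<tau>. 0 \<le> \<tau> 0 \<and> (\<forall>i<n. \<tau> i < \<tau> (Suc i)) \<longrightarrow>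
        prob_space.indep_vars M (\<lambda>_. borel)
          (\<lambda>i \<omega>. B (\<tau> (Suc i)) \<omega> - B (\<tau> i) \<omega>) {..<n})"

text \<open>Completeness of the underlying space (assumed below) makes the following the
  usual augmentation of the natural filtration, by all subsets of null sets.\<close>

definition augmented_filtration :: "'w measure \<Rightarrow> (real \<Rightarrow> 'w \<Rightarrow> real) \<Rightarrow> real \<Rightarrow> 'w measure" where
  "augmented_filtration M B t =
     sigma (space M)
       ({B s -` A \<inter> space M | s A. 0 \<le> s \<and> s \<le> t \<and> A \<in> sets borel} \<union> null_sets M)"

text \<open>A simple process is given by \<open>n\<close>, times \<open>\<tau> 0 \<le> \<dots> \<le> \<tau> n\<close> and bounded weights \<open>\<xi> i\<close>, where
  \<open>\<xi> i\<close> is known at time \<open>\<tau> i\<close> and acts on the interval \<open>(\<tau> i, \<tau> (Suc i)]\<close>.\<close>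

type_synonym 'w simple_process = "nat \<times> (nat \<Rightarrow> real) \<times> (nat \<Rightarrow> 'w \<Rightarrow> real)"

definition simple_process :: "'w measure \<Rightarrow> (real \<Rightarrow> 'w measure) \<Rightarrow> 'w simple_process \<Rightarrow> bool" where
  "simple_process M F = (\<lambda>(n, \<tau>, \<xi>).
     0 \<le> \<tau> 0 \<and> (\<forall>i<n. \<tau> i \<le> \<tau> (Suc i)) \<and>
     (\<forall>i<n. \<xi> i \<in> borel_measurable (F (\<tau> i))) \<and>
     (\<exists>C. \<forall>i<n. \<forall>\<omega>\<in>space M. \<bar>\<xi> i \<omega>\<bar> \<le> C))"

definition simple_value :: "'w simple_process \<Rightarrow> real \<Rightarrow> 'w \<Rightarrow> real" where
  "simple_value = (\<lambda>(n, \<tau>, \<xi>) s \<omega>.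
     \<Sum>i<n. \<xi> i \<omega> * indicator {\<tau> i<..\<tau> (Suc i)} s)"

definition simple_integral_upto ::
    "(real \<Rightarrow> 'w \<Rightarrow> real) \<Rightarrow> 'w simple_process \<Rightarrow> real \<Rightarrow> 'w \<Rightarrow> real" where
  "simple_integral_upto B = (\<lambda>(n, \<tau>, \<xi>) t \<omega>.
     \<Sum>i<n. \<xi> i \<omega> * (B (min t (\<tau> (Suc i))) \<omega> - B (min t (\<tau> i)) \<omega>))"

text \<open>\<open>has_ito_integral M F B H t J\<close>: the random variable \<open>J\<close> is (a version of) the stochastic
  integral of \<open>H\<close> against \<open>B\<close> over \<open>[0, t]\<close>, i.e. the mean-square limit of the integrals of
  simple processes that approximate \<open>H\<close> in mean square on \<open>[0, t] \<times> \<Omega>\<close>.\<close>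

definition has_ito_integral ::
    "'w measure \<Rightarrow> (real \<Rightarrow> 'w measure) \<Rightarrow> (real \<Rightarrow> 'w \<Rightarrow> real) \<Rightarrow> (real \<Rightarrow> 'w \<Rightarrow> real)
      \<Rightarrow> real \<Rightarrow> ('w \<Rightarrow> real) \<Rightarrow> bool" where
  "has_ito_integral M F B H t J \<longleftrightarrow>
     J \<in> borel_measurable (F t) \<and>
     (\<exists>S. (\<forall>k::nat. simple_process M F (S k)) \<and>
        (\<lambda>k. \<integral>\<^sup>+\<omega>. (\<integral>\<^sup>+s\<in>{0..t}. ennreal ((simple_value (S k) s \<omega> - H s \<omega>)\<^sup>2) \<partial>lborel) \<partial>M)
          \<longlonglongrightarrow> 0 \<and>
        (\<lambda>k. \<integral>\<^sup>+\<omega>. ennreal ((simple_integral_upto B (S k) t \<omega> - J \<omega>)\<^sup>2) \<partial>M) \<longlonglongrightarrow> 0)"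

text \<open>Strong means adapted to the augmented filtration of the driving Brownian motion. The Ito
  integral above only covers square-integrable integrands, which is enough for the bounded
  diffusion coefficient of interest.\<close>

definition strong_solution ::
    "'w measure \<Rightarrow> (real \<Rightarrow> 'w \<Rightarrow> real) \<Rightarrow> (real \<Rightarrow> real) \<Rightarrow> (real \<Rightarrow> real) \<Rightarrow> real
      \<Rightarrow> (real \<Rightarrow> 'w \<Rightarrow> real) \<Rightarrow> bool" where
  "strong_solution M B drift diffusion x X \<longleftrightarrow>
     (\<forall>t\<ge>0. X t \<in> borel_measurable (augmented_filtration M B t)) \<and>
     (\<forall>\<omega>\<in>space M. continuous_on {0..} (\<lambda>t. X t \<omega>)) \<and>
     (AE \<omega> in M. X 0 \<omega> = x) \<and>
     (\<forall>t\<ge>0. \<exists>J. has_ito_integral M (augmented_filtration M B) B (\<lambda>s \<omega>. diffusion (X s \<omega>)) t J \<and>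
        (AE \<omega> in M. set_integrable lborel {0..t} (\<lambda>s. drift (X s \<omega>)) \<and>
           X t \<omega> = X 0 \<omega> + (LBINT s:{0..t}. drift (X s \<omega>)) + J \<omega>))"

definition two_valued :: "real \<Rightarrow> real \<Rightarrow> real \<Rightarrow> real \<Rightarrow> real" where
  "two_valued a c1 c2 y = c1 * indicator {..a} y + c2 * indicator {a<..} y"

text \<open>For \<open>t > 0\<close>, the first hitting time density of \<open>0\<close> for a Brownian motion with drift \<open>\<mu>\<close> started
  at \<open>x\<close>; only positive times occur below.\<close>

definition h :: "real \<Rightarrow> real \<Rightarrow> real \<Rightarrow> real" where
  "h t x \<mu> = \<bar>x\<bar> / sqrt (2 * pi * t ^ 3) * exp (- ((x + \<mu> * t)\<^sup>2 / (2 * t)))"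

text \<open>The choice of pointwise representative is part of the definition: \<open>x = a\<close> and \<open>z = a\<close> belong to
  the upper cases, which makes the density right-continuous in \<open>z\<close> at \<open>a\<close>.\<close>

definition density_version ::
    "real \<Rightarrow> real \<Rightarrow> real \<Rightarrow> real \<Rightarrow> real \<Rightarrow> real \<Rightarrow> real \<Rightarrow> real \<Rightarrow> real" where
  "density_version a \<mu>1 \<mu>2 \<sigma>1 \<sigma>2 t x z =
    (if x \<ge> a then
       if z \<ge> a then
         2 / \<sigma>2\<^sup>2 * (LBINT b:{0<..}. LBINT \<tau>:{0<..<t}.
            exp (2 * \<mu>2 * (z - a) / \<sigma>2\<^sup>2) * exp (2 * \<mu>1 * b / \<sigma>1\<^sup>2)
            * h (t - \<tau>) (b / \<sigma>1) (\<mu>1 / \<sigma>1)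
            * h \<tau> ((z + x - 2 * a + b) / \<sigma>2) (\<mu>2 / \<sigma>2))
         + 1 / sqrt (2 * pi * t * \<sigma>2\<^sup>2) *
           (exp (- ((z - x - \<mu>2 * t)\<^sup>2 / (2 * t * \<sigma>2\<^sup>2)))
            - exp (- ((z + x - 2 * a - \<mu>2 * t)\<^sup>2 / (2 * t * \<sigma>2\<^sup>2)) - 2 * \<mu>2 * (x - a) / \<sigma>2\<^sup>2))
       else
         2 / \<sigma>1\<^sup>2 * (LBINT b:{0<..}. LBINT \<tau>:{0<..<t}.
            exp (2 * \<mu>1 * b / \<sigma>1\<^sup>2)
            * h (t - \<tau>) ((b - z + a) / \<sigma>1) (\<mu>1 / \<sigma>1)
            * h \<tau> ((x - a + b) / \<sigma>2) (\<mu>2 / \<sigma>2))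
     else
       if z < a then
         2 / \<sigma>1\<^sup>2 * (LBINT b:{..<0}. LBINT \<tau>:{0<..<t}.
            exp (2 * \<mu>1 * (z - a) / \<sigma>1\<^sup>2) * exp (2 * \<mu>2 * b / \<sigma>2\<^sup>2)
            * h (t - \<tau>) (b / \<sigma>2) (\<mu>2 / \<sigma>2)
            * h \<tau> ((z + x - 2 * a + b) / \<sigma>1) (\<mu>1 / \<sigma>1))
         + 1 / sqrt (2 * pi * t * \<sigma>1\<^sup>2) *
           (exp (- ((z - x - \<mu>1 * t)\<^sup>2 / (2 * t * \<sigma>1\<^sup>2)))
            - exp (- ((z + x - 2 * a - \<mu>1 * t)\<^sup>2 / (2 * t * \<sigma>1\<^sup>2)) - 2 * \<mu>1 * (x - a) / \<sigma>1\<^sup>2))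
       else
         2 / \<sigma>2\<^sup>2 * (LBINT b:{..<0}. LBINT \<tau>:{0<..<t}.
            exp (2 * \<mu>2 * b / \<sigma>2\<^sup>2)
            * h (t - \<tau>) ((b - z + a) / \<sigma>2) (\<mu>2 / \<sigma>2)
            * h \<tau> ((x - a + b) / \<sigma>1) (\<mu>1 / \<sigma>1)))"

end

(* In all four cases the exponential weight turns the double integral into an integral over b of
   convolutions of first hitting densities: with u = t - tau, v = tau, the integrand is
     (b + c) / u * N(m u, s^2 u)(b + c) * (b + d) / v * N(n v, r^2 v)(b + d),   m, n > 0.
   By the renewal heuristic its integral tends to 1 / (1/m + 1/n), since the two passages take the
   mean time b (1/m + 1/n) to leading order. To prove this, exchange the integrals and extend b to
   the whole line: the Gaussian integral in b is explicit, a bounded factor tending to m n times a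
   centred Gaussian density in D = n v - m u + c - d with variance s^2 u + r^2 v, and dominated
   convergence applies after the substitution D = sqrt t * w. The part b <= 0 is exponentially small
   in t because there both Gaussians are evaluated at a distance of order u, v from their means. *)

theory Submission
  imports Defs "HOL-Real_Asymp.Real_Asymp"
begin

section \<open>First passage densities in Gaussian form\<close>

text \<open>For \<open>y > 0\<close> and \<open>m, s > 0\<close> this is the density in
  \<open>u\<close> of the first time at which a Brownian motion with drift \<open>m\<close> and
  volatility \<open>s\<close> reaches level \<open>y\<close>. Writing it with a normal density in
  \<open>y\<close> makes the later integrals over the level Gaussian.\<close>

definition hitting_density :: "real \<Rightarrow> real \<Rightarrow> real \<Rightarrow> real \<Rightarrow> real" where
  "hitting_density m s u y = y / u * normal_density (m * u) (s * sqrt u) y"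

lemma borel_measurable_hitting_density [measurable]:
  assumes [measurable]: "f \<in> borel_measurable N" "g \<in> borel_measurable N"
  shows "(\<lambda>x. hitting_density m s (f x) (g x)) \<in> borel_measurable N"
  unfolding hitting_density_def normal_density_def by measurable

lemma hitting_density_nonneg: "u > 0 \<Longrightarrow> y \<ge> 0 \<Longrightarrow> hitting_density m s u y \<ge> 0"
  by (simp add: hitting_density_def)

lemma h_uminus: "h t (- x) (- \<mu>) = h t x \<mu>"
proof -
  have "(- x - \<mu> * t)\<^sup>2 = (x + \<mu> * t)\<^sup>2" by (simp add: power2_eq_square algebra_simps)
  then show ?thesis by (simp add: h_def)
qed

text \<open>Dividing space by \<open>s\<close> reduces to unit volatility; the factor
  \<open>1 / s\<close> in \<open>y / s\<close> becomes part of the Gaussian normalisation. For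
  \<open>m > 0\<close> the drift points toward the barrier, so no exponential weight occurs.\<close>

lemma h_eq_hitting_density:
  assumes "u > 0" "s > 0" "y \<ge> 0"
  shows "h u (y / s) (- m / s) = hitting_density m s u y"
proof -
  have 1: "sqrt (2 * pi * u ^ 3) = u * sqrt (2 * pi * u)"
    using assms by (simp add: real_sqrt_mult power3_eq_cube)
  have 2: "sqrt (2 * pi * (s * sqrt u)\<^sup>2) = s * sqrt (2 * pi * u)"
    using assms by (simp add: real_sqrt_mult power_mult_distrib)
  have 3: "(y / s + - m / s * u)\<^sup>2 / (2 * u) = (y - m * u)\<^sup>2 / (2 * (s * sqrt u)\<^sup>2)"
    using assms by (simp add: power_mult_distrib field_simps power2_eq_square)
  show ?thesis
    unfolding h_def hitting_density_def normal_density_def 1 2 3 using assms by simp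
qed

text \<open>For \<open>m > 0\<close> the process with drift away from the barrier hits it only with probability
  \<open>exp (- 2 m y / s\<^sup>2)\<close>; the exponential weight conditions on hitting and thereby reverses the drift.\<close>

lemma exp_h_eq_hitting_density:
  assumes "u > 0" "s > 0" "y \<ge> 0"
  shows "exp (2 * m * y / s\<^sup>2) * h u (y / s) (m / s) = hitting_density m s u y"
proof -
  have "2 * m * y / s\<^sup>2 - (y / s + m / s * u)\<^sup>2 / (2 * u) = - ((y / s + - m / s * u)\<^sup>2 / (2 * u))"
    using assms by (simp add: field_simps power2_eq_square)
  then have "exp (2 * m * y / s\<^sup>2) * exp (- ((y / s + m / s * u)\<^sup>2 / (2 * u)))
      = exp (- ((y / s + - m / s * u)\<^sup>2 / (2 * u)))"
    by (simp add: mult_exp_exp)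
  then have "exp (2 * m * y / s\<^sup>2) * h u (y / s) (m / s) = h u (y / s) (- m / s)"
    unfolding h_def by (simp add: mult.left_commute)
  then show ?thesis using h_eq_hitting_density[OF assms] by simp
qed

section \<open>Gaussian products and the integral over the whole line\<close>

text \<open>Completing the square in \<open>x\<close> leaves a Gaussian around the
  precision-weighted mean; the remaining factor is free of \<open>x\<close> and is a Gaussian in the
  difference of the means with the summed variance.\<close>

lemma normal_density_mult:
  assumes "v > 0" "w > 0"
  shows "normal_density \<mu> (sqrt v) x * normal_density \<nu> (sqrt w) x =
    normal_density 0 (sqrt (v + w)) (\<nu> - \<mu>) *
    normal_density ((\<mu> * w + \<nu> * v) / (v + w)) (sqrt (v * w / (v + w))) x"
proof -
  have S: "v + w > 0" "v + w \<noteq> 0" "v \<noteq> 0" "w \<noteq> 0" using assms by auto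
  have 1: "sqrt (2 * pi * v) * sqrt (2 * pi * w) =
      sqrt (2 * pi * (v + w)) * sqrt (2 * pi * (v * w / (v + w)))"
    using S by (simp add: real_sqrt_mult[symmetric] field_simps)
  have 2: "- (x - \<mu>)\<^sup>2 / (2 * v) + - (x - \<nu>)\<^sup>2 / (2 * w) =
     - (\<nu> - \<mu> - 0)\<^sup>2 / (2 * (v + w)) +
     - (x - (\<mu> * w + \<nu> * v) / (v + w))\<^sup>2 / (2 * (v * w / (v + w)))"
  proof -
    define S where "S = v + w"
    have x: "x - (\<mu> * w + \<nu> * v) / S = ((x - \<mu>) * w + (x - \<nu>) * v) / S"
      using \<open>v + w \<noteq> 0\<close> by (simp add: S_def field_simps)
    \<comment> \<open>Lagrange's identity for the vectors (\<open>sqrt w * (x - \<mu>)\<close>,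
      \<open>sqrt v * (x - \<nu>)\<close>) and (\<open>sqrt w\<close>,
      \<open>sqrt v\<close>).\<close>
    have y: "S * ((x - \<mu>)\<^sup>2 * w + (x - \<nu>)\<^sup>2 * v) =
      (\<nu> - \<mu>)\<^sup>2 * v * w + ((x - \<mu>) * w + (x - \<nu>) * v)\<^sup>2"
      unfolding S_def by algebra
    have "(x - \<mu>)\<^sup>2 / (2 * v) + (x - \<nu>)\<^sup>2 / (2 * w) =
        S * ((x - \<mu>)\<^sup>2 * w + (x - \<nu>)\<^sup>2 * v) / (2 * v * w * S)"
      using S by (simp add: S_def[symmetric] field_simps)
    also have "\<dots> = (\<nu> - \<mu>)\<^sup>2 / (2 * S) +
        (((x - \<mu>) * w + (x - \<nu>) * v) / S)\<^sup>2 / (2 * (v * w / S))"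
      unfolding y using S by (simp add: S_def[symmetric] field_simps power2_eq_square)
    finally show ?thesis unfolding S_def[symmetric] x by simp
  qed
  have "normal_density \<mu> (sqrt v) x * normal_density \<nu> (sqrt w) x =
     1 / (sqrt (2 * pi * v) * sqrt (2 * pi * w)) *
     exp (- (x - \<mu>)\<^sup>2 / (2 * v) + - (x - \<nu>)\<^sup>2 / (2 * w))"
    using assms by (simp add: normal_density_def mult_exp_exp)
  also have "\<dots> = normal_density 0 (sqrt (v + w)) (\<nu> - \<mu>) *
    normal_density ((\<mu> * w + \<nu> * v) / (v + w)) (sqrt (v * w / (v + w))) x"
    unfolding 1 2 using assms S(1) by (simp add: normal_density_def mult_exp_exp)
  finally show ?thesis .
qed

lemma normal_density_second_moment:
  assumes "v > 0"
  shows "has_bochner_integral lborel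
    (\<lambda>x. normal_density \<mu> (sqrt v) x * ((x + \<alpha>) * (x + \<beta>))) ((\<mu> + \<alpha>) * (\<mu> + \<beta>) + v)"
proof -
  have s: "sqrt v > 0" using assms by simp
  \<comment> \<open>Expansion of \<open>(x + \<alpha>) * (x + \<beta>)\<close> around the mean:
    variance, a vanishing odd moment, total mass. The exponents are spelled out to show which
    central moments are even and which odd.\<close>
  have "has_bochner_integral lborel (\<lambda>x. normal_density \<mu> (sqrt v) x * (x - \<mu>) ^ (2 * 1)
     + (2 * \<mu> + \<alpha> + \<beta>) * (normal_density \<mu> (sqrt v) x * (x - \<mu>) ^ (2 * 0 + 1))
     + (\<mu> + \<alpha>) * (\<mu> + \<beta>) * (normal_density \<mu> (sqrt v) x * (x - \<mu>) ^ (2 * 0)))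
     (fact (2 * 1) / ((2 / (sqrt v)\<^sup>2) ^ 1 * fact 1) + (2 * \<mu> + \<alpha> + \<beta>) * 0
      + (\<mu> + \<alpha>) * (\<mu> + \<beta>) * (fact (2 * 0) / ((2 / (sqrt v)\<^sup>2) ^ 0 * fact 0)))"
    by (intro has_bochner_integral_add has_bochner_integral_mult_right
        normal_moment_even normal_moment_odd s)
  moreover have "fact (2 * 1) / ((2 / (sqrt v)\<^sup>2) ^ 1 * fact 1) + (2 * \<mu> + \<alpha> + \<beta>) * 0
      + (\<mu> + \<alpha>) * (\<mu> + \<beta>) * (fact (2 * 0) / ((2 / (sqrt v)\<^sup>2) ^ 0 * fact 0))
      = (\<mu> + \<alpha>) * (\<mu> + \<beta>) + v"
    using assms by (simp add: fact_numeral numeral_2_eq_2)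
  moreover have "(\<lambda>x. normal_density \<mu> (sqrt v) x * (x - \<mu>) ^ (2 * 1)
     + (2 * \<mu> + \<alpha> + \<beta>) * (normal_density \<mu> (sqrt v) x * (x - \<mu>) ^ (2 * 0 + 1))
     + (\<mu> + \<alpha>) * (\<mu> + \<beta>) * (normal_density \<mu> (sqrt v) x * (x - \<mu>) ^ (2 * 0)))
     = (\<lambda>x. normal_density \<mu> (sqrt v) x * ((x + \<alpha>) * (x + \<beta>)))"
    by (intro ext) (simp add: power2_eq_square algebra_simps)
  ultimately show ?thesis by (simp add: add.commute)
qed

lemma normal_density_shift: "normal_density \<mu> \<sigma> (x + c) = normal_density (\<mu> - c) \<sigma> x"
  by (simp add: normal_density_def algebra_simps)

lemma hitting_density_shift:
  assumes "u > 0" "s > 0"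
  shows "hitting_density m s u (b + c) = (b + c) / u * normal_density (m * u - c) (sqrt (s\<^sup>2 * u)) b"
  using assms by (simp add: hitting_density_def normal_density_shift real_sqrt_mult)

text \<open>The weights \<open>(b + c) / u\<close> and \<open>(b + d) / v\<close> cancel the factors \<open>u\<close> and \<open>v\<close> that appear in the
  shifted mean of the product Gaussian, so the integral over the whole line has no singularity at
  \<open>u = 0\<close> or \<open>v = 0\<close>.\<close>

definition line_mass :: "real \<Rightarrow> real \<Rightarrow> real \<Rightarrow> real \<Rightarrow> real \<Rightarrow> real \<Rightarrow> real" where
  "line_mass m s n r S D =
     ((m + s\<^sup>2 * (D / S)) * (n - r\<^sup>2 * (D / S)) + s\<^sup>2 * r\<^sup>2 / S) * normal_density 0 (sqrt S) D"

text \<open>In \<open>b\<close> both factors are linear functions times Gaussians, with means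
  \<open>m * u - c\<close> and \<open>n * v - d\<close>. The product formula reduces the integral to
  a second moment, and the difference of the means becomes the last argument of
  \<open>line_mass\<close>.\<close>

lemma integral_hitting_density_line:
  assumes "u > 0" "v > 0" "s > 0" "r > 0"
  shows "has_bochner_integral lborel
     (\<lambda>b. hitting_density m s u (b + c) * hitting_density n r v (b + d))
     (line_mass m s n r (s\<^sup>2 * u + r\<^sup>2 * v) (n * v - m * u + (c - d)))"
proof -
  define S where "S = s\<^sup>2 * u + r\<^sup>2 * v"
  define D where "D = n * v - m * u + (c - d)"
  define M where "M = ((m * u - c) * (r\<^sup>2 * v) + (n * v - d) * (s\<^sup>2 * u)) / S"
  define V where "V = (s\<^sup>2 * u) * (r\<^sup>2 * v) / S"
  have pos: "s\<^sup>2 * u > 0" "r\<^sup>2 * v > 0" using assms by auto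
  then have S: "S > 0" unfolding S_def by simp
  have V: "V > 0" unfolding V_def using pos S by simp
  \<comment> \<open>\<open>M\<close> lies between the two means, displaced from
    \<open>m * u - c\<close> by the fraction \<open>s\<^sup>2 * u / S\<close> of \<open>D\<close>
    and from \<open>n * v - d\<close> by the fraction \<open>r\<^sup>2 * v / S\<close>.\<close>
  have Mc: "M + c = u * (m + s\<^sup>2 * (D / S))" and Md: "M + d = v * (n - r\<^sup>2 * (D / S))"
    using S unfolding M_def D_def by (simp_all add: field_simps) (simp_all add: S_def algebra_simps)
  have fun_eq: "hitting_density m s u (b + c) * hitting_density n r v (b + d) =
      normal_density 0 (sqrt S) D / (u * v) * (normal_density M (sqrt V) b * ((b + c) * (b + d)))" for b
  proof -
    have "normal_density (m * u - c) (sqrt (s\<^sup>2 * u)) b * normal_density (n * v - d) (sqrt (r\<^sup>2 * v)) b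
        = normal_density 0 (sqrt S) D * normal_density M (sqrt V) b"
      using normal_density_mult[OF pos, of "m * u - c" b "n * v - d"]
      by (simp add: S_def D_def M_def V_def algebra_simps)
    then show ?thesis
      using assms by (simp add: hitting_density_shift field_simps)
  qed
  have V': "V / (u * v) = s\<^sup>2 * r\<^sup>2 / S"
    unfolding V_def using assms by (simp add: field_simps)
  have val: "normal_density 0 (sqrt S) D / (u * v) * ((M + c) * (M + d) + V) = line_mass m s n r S D"
  proof -
    have "((M + c) * (M + d) + V) / (u * v) = (M + c) * (M + d) / (u * v) + V / (u * v)"
      by (rule add_divide_distrib)
    also have "\<dots> = (m + s\<^sup>2 * (D / S)) * (n - r\<^sup>2 * (D / S)) + s\<^sup>2 * r\<^sup>2 / S"
      unfolding Mc Md V' using assms by (simp add: mult.assoc mult.left_commute)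
    finally show ?thesis unfolding line_mass_def by (metis mult.commute times_divide_eq_left times_divide_eq_right)
  qed
  show ?thesis
    unfolding fun_eq S_def[symmetric] D_def[symmetric] val[symmetric]
    by (intro has_bochner_integral_mult_right normal_density_second_moment V)
qed

section \<open>Exponential smallness of the part \<open>b \<le> 0\<close>\<close>

text \<open>The product depends on \<open>y\<close> and \<open>\<sigma>\<close> only through
  \<open>x = \<bar>y\<bar> / \<sigma>\<close>, so the bound is uniform in the scale and therefore in
  time. It follows from \<open>x \<le> 1 + x\<^sup>2 / 2 \<le> exp (x\<^sup>2 / 2)\<close>.\<close>

lemma normal_density_times_abs_le_1:
  assumes "\<sigma> > 0"
  shows "normal_density 0 \<sigma> y * \<bar>y\<bar> \<le> 1"
proof -
  define x where "x = \<bar>y\<bar> / \<sigma>"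
  have "x \<le> 1 + x\<^sup>2 / 2" using sum_squares_ge_zero[of "x - 1" 1] by (simp add: power2_eq_square algebra_simps)
  also have "\<dots> \<le> exp (x\<^sup>2 / 2)" by (rule exp_ge_add_one_self)
  finally have x: "x * exp (- (x\<^sup>2 / 2)) \<le> 1" by (simp add: exp_minus divide_simps)
  have pi: "1 \<le> sqrt (2 * pi)" using pi_ge_two by simp
  have "normal_density 0 \<sigma> y * \<bar>y\<bar> = x * exp (- (x\<^sup>2 / 2)) / sqrt (2 * pi)"
    using assms by (simp add: normal_density_def x_def real_sqrt_mult power_divide field_simps)
  also have "\<dots> \<le> 1" using order_trans[OF x pi] by (simp add: divide_le_eq)
  finally show ?thesis .
qed

text \<open>Removing the drift from the Gaussian produces the Cameron-Martin factor \<open>exp (m *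
  (b + c) / s\<^sup>2 - m\<^sup>2 * u / (2 * s\<^sup>2))\<close>. For \<open>b \<le> 0\<close> its
  part in \<open>b\<close> is at most 1, and the decay in \<open>u\<close> remains.\<close>

lemma abs_hitting_density_le:
  assumes "u > 0" "s > 0" "m \<ge> 0" "b \<le> 0"
  shows "\<bar>hitting_density m s u (b + c)\<bar> \<le>
    exp (m * c / s\<^sup>2) * exp (- (m\<^sup>2 / (2 * s\<^sup>2) * u)) * (normal_density 0 (s * sqrt u) (b + c) * \<bar>b + c\<bar> / u)"
proof -
  have "- (b + c - m * u)\<^sup>2 / (2 * (s * sqrt u)\<^sup>2) =
      m * b / s\<^sup>2 + m * c / s\<^sup>2 - m\<^sup>2 / (2 * s\<^sup>2) * u - (b + c)\<^sup>2 / (2 * (s * sqrt u)\<^sup>2)"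
    using assms by (simp add: power_mult_distrib field_simps power2_eq_square)
  also have "\<dots> \<le> m * c / s\<^sup>2 - m\<^sup>2 / (2 * s\<^sup>2) * u - (b + c)\<^sup>2 / (2 * (s * sqrt u)\<^sup>2)"
    using assms by (simp add: divide_le_0_iff mult_nonneg_nonpos)
  finally have "exp (- (b + c - m * u)\<^sup>2 / (2 * (s * sqrt u)\<^sup>2)) \<le>
      exp (m * c / s\<^sup>2) * exp (- (m\<^sup>2 / (2 * s\<^sup>2) * u)) * exp (- (b + c)\<^sup>2 / (2 * (s * sqrt u)\<^sup>2))"
    by (simp add: mult_exp_exp)
  then have "normal_density (m * u) (s * sqrt u) (b + c) \<le>
      exp (m * c / s\<^sup>2) * exp (- (m\<^sup>2 / (2 * s\<^sup>2) * u)) * normal_density 0 (s * sqrt u) (b + c)"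
    unfolding normal_density_def by (simp add: divide_right_mono)
  then have "\<bar>b + c\<bar> / u * normal_density (m * u) (s * sqrt u) (b + c) \<le>
      \<bar>b + c\<bar> / u * (exp (m * c / s\<^sup>2) * exp (- (m\<^sup>2 / (2 * s\<^sup>2) * u)) * normal_density 0 (s * sqrt u) (b + c))"
    using assms by (intro mult_left_mono) auto
  then show ?thesis
    using assms by (simp add: hitting_density_def abs_mult mult_ac)
qed

text \<open>One factor is bounded by its supremum, the other one is integrated. Exchanging the roles of the
  two factors then allows the larger of \<open>u\<close>, \<open>v\<close> to carry the non-integrable power.\<close>

lemma abs_tail_mass_le:
  assumes "u > 0" "v > 0" "s > 0" "r > 0" "m \<ge> 0" "n \<ge> 0"
  shows "\<bar>LBINT b:{..0}. hitting_density m s u (b + c) * hitting_density n r v (b + d)\<bar> \<le>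
    exp (m * c / s\<^sup>2) * exp (- (m\<^sup>2 / (2 * s\<^sup>2) * u)) *
    (exp (n * d / r\<^sup>2) * exp (- (n\<^sup>2 / (2 * r\<^sup>2) * v))) * (r / (u * sqrt v))"
proof -
  define K where "K = exp (m * c / s\<^sup>2) * exp (- (m\<^sup>2 / (2 * s\<^sup>2) * u))"
  define L where "L = exp (n * d / r\<^sup>2) * exp (- (n\<^sup>2 / (2 * r\<^sup>2) * v))"
  have KL: "K > 0" "L > 0" by (auto simp: K_def L_def)
  \<comment> \<open>\<open>K / u\<close> bounds the first factor; in the second,
    \<open>1 / v\<close> meets a first absolute moment of order \<open>sqrt v\<close>, which leaves
    \<open>1 / sqrt v\<close>.\<close>
  define w where "w b = K * L / (u * v) * (normal_density 0 (r * sqrt v) (b + d) * \<bar>b + d\<bar>)" for b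
  have "has_bochner_integral lborel (\<lambda>b. normal_density (- d) (r * sqrt v) b * \<bar>b - (- d)\<bar> ^ (2 * 0 + 1))
      (2 ^ 0 * (r * sqrt v) ^ (2 * 0 + 1) * fact 0 * sqrt (2 / pi))"
    using assms by (intro normal_moment_abs_odd) simp
  then have "has_bochner_integral lborel (\<lambda>b. normal_density 0 (r * sqrt v) (b + d) * \<bar>b + d\<bar>)
      (r * sqrt v * sqrt (2 / pi))"
    by (simp add: normal_density_shift)
  then have w: "has_bochner_integral lborel w (K * L / (u * v) * (r * sqrt v * sqrt (2 / pi)))"
    unfolding w_def by (rule has_bochner_integral_mult_right)
  let ?f = "\<lambda>b. indicator {..0} b *\<^sub>R (hitting_density m s u (b + c) * hitting_density n r v (b + d))"
  have le: "norm (?f b) \<le> w b" for b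
  proof (cases "b \<le> 0")
    case True
    have "\<bar>hitting_density m s u (b + c)\<bar> \<le> K * (normal_density 0 (s * sqrt u) (b + c) * \<bar>b + c\<bar> / u)"
      unfolding K_def using assms True by (intro abs_hitting_density_le)
    also have "\<dots> \<le> K * (1 / u)"
      using assms KL by (intro mult_left_mono divide_right_mono normal_density_times_abs_le_1) auto
    finally have 1: "\<bar>hitting_density m s u (b + c)\<bar> \<le> K * (1 / u)" .
    have 2: "\<bar>hitting_density n r v (b + d)\<bar> \<le> L * (normal_density 0 (r * sqrt v) (b + d) * \<bar>b + d\<bar> / v)"
      unfolding L_def using assms True by (intro abs_hitting_density_le)
    have "norm (?f b) = \<bar>hitting_density m s u (b + c)\<bar> * \<bar>hitting_density n r v (b + d)\<bar>"
      using True by (simp add: abs_mult)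
    also have "\<dots> \<le> (K * (1 / u)) * (L * (normal_density 0 (r * sqrt v) (b + d) * \<bar>b + d\<bar> / v))"
      using KL assms by (intro mult_mono 1 2) auto
    also have "\<dots> = w b" using assms by (simp add: w_def field_simps)
    finally show ?thesis .
  next
    case False
    then show ?thesis using KL assms by (simp add: w_def)
  qed
  have sq: "sqrt (2 / pi) \<le> 1" using pi_ge_two by simp
  have "\<bar>LBINT b:{..0}. hitting_density m s u (b + c) * hitting_density n r v (b + d)\<bar> \<le> integral\<^sup>L lborel w"
    unfolding set_lebesgue_integral_def
    using Bochner_Integration.integral_norm_bound_integral[OF _ integrable.intros[OF w] le]
      integrable_mult_indicator[OF _ integrable.intros[OF integral_hitting_density_line[OF assms(1-4)]]]
    by (auto simp: real_norm_def)
  also have "\<dots> = K * L / (u * v) * (r * sqrt v * sqrt (2 / pi))"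
    using w by (rule has_bochner_integral_integral_eq)
  also have "\<dots> \<le> K * L / (u * v) * (r * sqrt v * 1)"
    using KL assms sq by (intro mult_left_mono) auto
  also have "\<dots> = K * L * (r / (u * sqrt v))"
  proof -
    have "sqrt v / v = 1 / sqrt v" using assms by (simp add: real_div_sqrt field_simps)
    then show ?thesis using assms by (simp add: field_simps)
  qed
  finally show ?thesis unfolding K_def L_def by (simp add: mult_ac)
qed

text \<open>At least one of \<open>u\<close>, \<open>v\<close> is \<open>\<ge> 1\<close>, and
  letting that one carry the full power leaves only inverse square roots, integrable at both ends of
  the time interval. The common rate \<open>k\<close> makes the exponential depend on
  \<open>u + v\<close> alone, which is constant along a convolution.\<close>

lemma abs_tail_mass_le_inverse_sqrt:
  assumes "u > 0" "v > 0" "u + v \<ge> 2" "s > 0" "r > 0" "m \<ge> 0" "n \<ge> 0"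
    and "k \<le> m\<^sup>2 / (2 * s\<^sup>2)" "k \<le> n\<^sup>2 / (2 * r\<^sup>2)"
  shows "\<bar>LBINT b:{..0}. hitting_density m s u (b + c) * hitting_density n r v (b + d)\<bar> \<le>
    exp (m * c / s\<^sup>2) * exp (n * d / r\<^sup>2) * (r + s) * exp (- (k * (u + v))) * (1 / sqrt u + 1 / sqrt v)"
proof -
  let ?E = "exp (m * c / s\<^sup>2) * exp (n * d / r\<^sup>2)"
  let ?I = "\<bar>LBINT b:{..0}. hitting_density m s u (b + c) * hitting_density n r v (b + d)\<bar>"
  have k: "exp (- (m\<^sup>2 / (2 * s\<^sup>2) * u)) * exp (- (n\<^sup>2 / (2 * r\<^sup>2) * v)) \<le> exp (- (k * (u + v)))"
    using mult_right_mono[OF assms(8), of u] mult_right_mono[OF assms(9), of v] assms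
    by (simp add: mult_exp_exp algebra_simps)
  have step: "?I \<le> ?E * exp (- (k * (u + v))) * X"
    if "?I \<le> exp (m * c / s\<^sup>2) * exp (- (m\<^sup>2 / (2 * s\<^sup>2) * u)) *
      (exp (n * d / r\<^sup>2) * exp (- (n\<^sup>2 / (2 * r\<^sup>2) * v))) * Y" "Y \<le> X" "Y \<ge> 0" for X Y
  proof -
    have "?I \<le> ?E * (exp (- (m\<^sup>2 / (2 * s\<^sup>2) * u)) * exp (- (n\<^sup>2 / (2 * r\<^sup>2) * v))) * Y"
      using that by (simp add: mult_ac)
    also have "\<dots> \<le> ?E * exp (- (k * (u + v))) * X"
      using that by (intro mult_mono k) auto
    finally show ?thesis .
  qed
  have nn: "1 / sqrt u \<ge> 0" "1 / sqrt v \<ge> 0" using assms by auto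
  have "?I \<le> ?E * exp (- (k * (u + v))) * ((r + s) * (1 / sqrt u + 1 / sqrt v))"
  proof (cases "u \<ge> 1")
    case True
    have "r / (u * sqrt v) \<le> r / (1 * sqrt v)"
      using assms True by (intro divide_left_mono mult_right_mono) auto
    also have "\<dots> = r * (1 / sqrt v)" by simp
    also have "\<dots> \<le> (r + s) * (1 / sqrt u + 1 / sqrt v)"
      using assms nn by (intro mult_mono) auto
    finally show ?thesis
      using assms by (intro step[OF abs_tail_mass_le]) auto
  next
    case False
    then have v: "v \<ge> 1" using assms by simp
    have "s / (v * sqrt u) \<le> s / (1 * sqrt u)"
      using assms v by (intro divide_left_mono mult_right_mono) auto
    also have "\<dots> = s * (1 / sqrt u)" by simp
    also have "\<dots> \<le> (r + s) * (1 / sqrt u + 1 / sqrt v)"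
      using assms nn by (intro mult_mono) auto
    finally have *: "s / (v * sqrt u) \<le> (r + s) * (1 / sqrt u + 1 / sqrt v)" .
    \<comment> \<open>The integrand is symmetric in the two passages, so the tail bound may be
      applied with their roles exchanged.\<close>
    have "?I \<le> exp (m * c / s\<^sup>2) * exp (- (m\<^sup>2 / (2 * s\<^sup>2) * u)) *
      (exp (n * d / r\<^sup>2) * exp (- (n\<^sup>2 / (2 * r\<^sup>2) * v))) * (s / (v * sqrt u))"
      using abs_tail_mass_le[of v u r s n m d c] assms by (simp add: mult_ac)
    then show ?thesis
      by (rule step[OF _ *]) (use assms in auto)
  qed
  then show ?thesis by (simp only: mult_ac)
qed

text \<open>The integrand is unbounded at 0, so the fundamental theorem is used on the open
  interval: nonnegativity and one-sided limits of the primitive \<open>2 * sqrt x\<close> yield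
  integrability as well as the value.\<close>

lemma has_bochner_integral_inverse_sqrt:
  assumes "t > 0"
  shows "has_bochner_integral lborel (\<lambda>x. indicator {0<..<t} x *\<^sub>R (1 / sqrt x)) (2 * sqrt t)"
proof -
  have D: "DERIV (\<lambda>x. 2 * sqrt x) x :> 1 / sqrt x" if "0 < x" for x :: real
    using that by (auto intro!: derivative_eq_intros simp: field_simps)
  have F0: "(((\<lambda>x. 2 * sqrt x) \<circ> real_of_ereal) \<longlongrightarrow> 2 * sqrt 0) (at_right (ereal 0))"
    and Ft: "(((\<lambda>x. 2 * sqrt x) \<circ> real_of_ereal) \<longlongrightarrow> 2 * sqrt t) (at_left (ereal t))"
    unfolding ereal_tendsto_simps by (intro tendsto_intros)+
  have C: "isCont (\<lambda>x. 1 / sqrt x) x" if "0 < x" for x :: real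
    using that by (intro continuous_intros) auto
  have N: "AE x in lborel. ereal 0 < ereal x \<longrightarrow> ereal x < ereal t \<longrightarrow> 0 \<le> 1 / sqrt x"
    by auto
  have lt: "ereal 0 < ereal t" using assms by simp
  note I = interval_integral_FTC_nonneg[OF lt _ _ N F0 Ft]
  have "set_integrable lborel {0<..<t} (\<lambda>x. 1 / sqrt x)"
    using I(1) D C by simp
  moreover have "(LBINT x:{0<..<t}. 1 / sqrt x) = 2 * sqrt t"
    using I(2) D C assms by (simp add: interval_lebesgue_integral_def)
  ultimately show ?thesis
    unfolding set_integrable_def set_lebesgue_integral_def by (simp add: has_bochner_integral_iff)
qed

section \<open>Limit of the whole-line contribution\<close>

text \<open>Provides a majorant that depends on \<open>t\<close> only through
  \<open>D / sqrt t\<close>; the factor \<open>sqrt t\<close> is, up to a constant, the Jacobian of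
  that substitution. \<open>D / S\<close> stays bounded because \<open>D\<close> is at most and
  \<open>S\<close> at least of order \<open>t\<close>.\<close>

lemma abs_line_mass_le:
  assumes "t \<ge> 1" "lo > 0" "lo * t \<le> S" "S \<le> hi * t" "\<bar>D\<bar> \<le> A * t"
  shows "sqrt t * \<bar>line_mass m s n r S D\<bar> \<le>
    ((\<bar>m\<bar> + s\<^sup>2 * (A / lo)) * (\<bar>n\<bar> + r\<^sup>2 * (A / lo)) + s\<^sup>2 * r\<^sup>2 / lo) * sqrt (hi / lo)
      * normal_density 0 (sqrt hi) (D / sqrt t)"
proof -
  have "0 < lo * t" using assms by simp
  then have S: "S > 0" using assms by linarith
  then have "hi * t > 0" using assms by linarith
  then have hi: "hi > 0" using assms by (simp add: zero_less_mult_iff)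
  have "0 \<le> A * t" using assms by linarith
  then have A: "A \<ge> 0" using assms by (simp add: zero_le_mult_iff)
  \<comment> \<open>Here \<open>t \<ge> 1\<close> keeps \<open>S\<close> away from 0, which bounds
    the term \<open>s\<^sup>2 * r\<^sup>2 / S\<close>.\<close>
  have "lo \<le> lo * t" using assms by simp
  then have loS: "lo \<le> S" using assms by linarith
  have "\<bar>D / S\<bar> \<le> A * t / (lo * t)"
    unfolding abs_divide using assms S A by (intro frac_le) auto
  then have DS: "\<bar>D / S\<bar> \<le> A / lo" using assms by simp
  have 1: "\<bar>m + s\<^sup>2 * (D / S)\<bar> \<le> \<bar>m\<bar> + s\<^sup>2 * (A / lo)"
    using mult_left_mono[OF DS, of "s\<^sup>2"] abs_triangle_ineq[of m "s\<^sup>2 * (D / S)"] by (simp add: abs_mult)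
  have 2: "\<bar>n - r\<^sup>2 * (D / S)\<bar> \<le> \<bar>n\<bar> + r\<^sup>2 * (A / lo)"
    using mult_left_mono[OF DS, of "r\<^sup>2"] abs_triangle_ineq4[of n "r\<^sup>2 * (D / S)"] by (simp add: abs_mult)
  have "\<bar>(m + s\<^sup>2 * (D / S)) * (n - r\<^sup>2 * (D / S))\<bar> \<le> (\<bar>m\<bar> + s\<^sup>2 * (A / lo)) * (\<bar>n\<bar> + r\<^sup>2 * (A / lo))"
    unfolding abs_mult using 1 2 by (intro mult_mono) auto
  moreover have "\<bar>s\<^sup>2 * r\<^sup>2 / S\<bar> \<le> s\<^sup>2 * r\<^sup>2 / lo"
    using loS S assms by (simp add: divide_left_mono)
  ultimately have 3: "\<bar>(m + s\<^sup>2 * (D / S)) * (n - r\<^sup>2 * (D / S)) + s\<^sup>2 * r\<^sup>2 / S\<bar> \<le>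
      (\<bar>m\<bar> + s\<^sup>2 * (A / lo)) * (\<bar>n\<bar> + r\<^sup>2 * (A / lo)) + s\<^sup>2 * r\<^sup>2 / lo" (is "?L \<le> ?P")
    by linarith
  \<comment> \<open>The exponent takes the upper bound of \<open>S\<close>, the normalisation the
    lower one; the mismatch is the factor \<open>sqrt (hi / lo)\<close>.\<close>
  have "D\<^sup>2 / (2 * S) \<ge> D\<^sup>2 / (2 * (hi * t))"
    using assms S by (intro divide_left_mono) auto
  then have 4: "exp (- D\<^sup>2 / (2 * S)) \<le> exp (- (D / sqrt t)\<^sup>2 / (2 * hi))"
    using assms by (simp add: power_divide mult_ac)
  have 5: "sqrt t / sqrt S \<le> 1 / sqrt lo"
  proof -
    have "sqrt lo * sqrt t \<le> sqrt S" using assms by (simp add: real_sqrt_mult[symmetric])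
    then show ?thesis using assms S by (simp add: divide_simps mult.commute)
  qed
  have "sqrt t * normal_density 0 (sqrt S) D = sqrt t / sqrt S * exp (- D\<^sup>2 / (2 * S)) / sqrt (2 * pi)"
    using S by (simp add: normal_density_def real_sqrt_mult)
  also have "\<dots> \<le> 1 / sqrt lo * exp (- (D / sqrt t)\<^sup>2 / (2 * hi)) / sqrt (2 * pi)"
    using assms S by (intro divide_right_mono mult_mono 4 5) auto
  also have "\<dots> = sqrt (hi / lo) * normal_density 0 (sqrt hi) (D / sqrt t)"
    using hi assms by (simp add: normal_density_def real_sqrt_mult real_sqrt_divide)
  finally have 6: "sqrt t * normal_density 0 (sqrt S) D \<le> sqrt (hi / lo) * normal_density 0 (sqrt hi) (D / sqrt t)" .
  have "sqrt t * \<bar>line_mass m s n r S D\<bar> = ?L * (sqrt t * normal_density 0 (sqrt S) D)"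
    by (simp add: line_mass_def abs_mult mult_ac)
  also have "\<dots> \<le> ?P * (sqrt (hi / lo) * normal_density 0 (sqrt hi) (D / sqrt t))"
    using 3 assms by (intro mult_mono 6) auto
  finally show ?thesis by (simp only: mult_ac)
qed

text \<open>Expresses everything through \<open>w / sqrt t\<close> and \<open>S / t\<close>,
  quantities that converge for fixed \<open>w\<close> under the substitution made next.\<close>

lemma line_mass_scale:
  assumes "t > 0" "S > 0"
  shows "sqrt t * line_mass m s n r S (sqrt t * w) =
    ((m + s\<^sup>2 * ((w / sqrt t) / (S / t))) * (n - r\<^sup>2 * ((w / sqrt t) / (S / t))) + s\<^sup>2 * r\<^sup>2 / t / (S / t))
      * normal_density 0 (sqrt (S / t)) w"
proof -
  have 1: "sqrt t * w / S = (w / sqrt t) / (S / t)"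
    using assms by (simp add: field_simps)
  have 2: "sqrt t * normal_density 0 (sqrt S) (sqrt t * w) = normal_density 0 (sqrt (S / t)) w"
    using assms by (simp add: normal_density_def real_sqrt_mult real_sqrt_divide power_mult_distrib field_simps)
  show ?thesis
    unfolding line_mass_def 1 2[symmetric] using assms by simp
qed

lemma borel_measurable_line_mass [measurable]:
  assumes [measurable]: "f \<in> borel_measurable N" "g \<in> borel_measurable N"
  shows "(\<lambda>x. line_mass m s n r (f x) (g x)) \<in> borel_measurable N"
  unfolding line_mass_def normal_density_def by measurable

text \<open>The mean part \<open>n * \<tau> - m * (t - \<tau>)\<close> vanishes at
  \<open>\<tau> = m * t / (m + n)\<close>, and the mass concentrates within order
  \<open>sqrt t\<close> of that time. There the polynomial factor tends to \<open>m * n\<close>, the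
  substitution contributes \<open>1 / (m + n)\<close>, and the limiting Gaussian has mass 1.
  Integrability comes from the same majorant.\<close>

lemma
  fixes m n s r \<delta> :: real
  assumes "m > 0" "n > 0" "s > 0" "r > 0"
  shows set_integrable_line_mass:
      "eventually (\<lambda>t. set_integrable lborel {0<..<t}
        (\<lambda>\<tau>. line_mass m s n r (s\<^sup>2 * (t - \<tau>) + r\<^sup>2 * \<tau>) (n * \<tau> - m * (t - \<tau>) + \<delta>))) at_top" (is ?integrable)
    and tendsto_integral_line_mass:
      "((\<lambda>t. LBINT \<tau>:{0<..<t}. line_mass m s n r (s\<^sup>2 * (t - \<tau>) + r\<^sup>2 * \<tau>) (n * \<tau> - m * (t - \<tau>) + \<delta>))
        \<longlongrightarrow> m * n / (m + n)) at_top" (is ?limit)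
proof -
  define S where "S t \<tau> = s\<^sup>2 * (t - \<tau>) + r\<^sup>2 * \<tau>" for t \<tau> :: real
  define D where "D t \<tau> = n * \<tau> - m * (t - \<tau>) + \<delta>" for t \<tau> :: real
  define g where "g t \<tau> = indicator {0<..<t} \<tau> *\<^sub>R line_mass m s n r (S t \<tau>) (D t \<tau>)" for t \<tau>
  \<comment> \<open>the substitution that turns \<open>D t \<tau>\<close> into \<open>sqrt t * w\<close>\<close>
  define T where "T t w = (m * t - \<delta>) / (m + n) + sqrt t / (m + n) * w" for t w
  \<comment> \<open>\<open>F\<close> includes the Jacobian. Since \<open>g t\<close> vanishes
    outside \<open>{0<..<t}\<close>, \<open>F t\<close> lives on the whole line and one dominating
    function serves for all \<open>t \<ge> 1\<close>.\<close>
  define F where "F t w = sqrt t / (m + n) * g t (T t w)" for t w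
  define lo where "lo = min (s\<^sup>2) (r\<^sup>2)"
  define hi where "hi = max (s\<^sup>2) (r\<^sup>2)"
  \<comment> \<open>Chosen so that \<open>\<bar>D t \<tau>\<bar> \<le> A * t\<close> whenever
    \<open>0 < \<tau> < t\<close> and \<open>t \<ge> 1\<close>.\<close>
  define A where "A = m + n + \<bar>\<delta>\<bar>"
  define P where "P = ((\<bar>m\<bar> + s\<^sup>2 * (A / lo)) * (\<bar>n\<bar> + r\<^sup>2 * (A / lo)) + s\<^sup>2 * r\<^sup>2 / lo) * sqrt (hi / lo) / (m + n)"
  have mn: "m + n > 0" using assms by simp
  have lo: "lo > 0" and hi: "hi > 0" using assms by (auto simp: lo_def hi_def min_def max_def)
  have A: "A \<ge> 0" using assms by (simp add: A_def)
  have P: "P \<ge> 0" using lo hi A mn by (simp add: P_def)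
  have DT: "D t (T t w) = sqrt t * w" for t w
  proof -
    have "D t (T t w) = (m + n) * T t w - m * t + \<delta>" by (simp add: D_def algebra_simps)
    then show ?thesis using mn by (simp add: T_def distrib_left)
  qed
  have S_lo: "lo * t \<le> S t \<tau>" and S_hi: "S t \<tau> \<le> hi * t" if "0 < \<tau>" "\<tau> < t" for t \<tau>
  proof -
    have "lo * (t - \<tau>) \<le> s\<^sup>2 * (t - \<tau>)" "lo * \<tau> \<le> r\<^sup>2 * \<tau>" "s\<^sup>2 * (t - \<tau>) \<le> hi * (t - \<tau>)" "r\<^sup>2 * \<tau> \<le> hi * \<tau>"
      using that by (intro mult_right_mono; simp add: lo_def hi_def)+
    then show "lo * t \<le> S t \<tau>" "S t \<tau> \<le> hi * t" by (simp_all add: S_def algebra_simps)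
  qed
  have bound: "norm (F t w) \<le> P * normal_density 0 (sqrt hi) w" if t: "t \<ge> 1" for t w
  proof (cases "0 < T t w \<and> T t w < t")
    case True
    have "\<bar>D t (T t w)\<bar> \<le> A * t"
    proof -
      have "n * T t w \<le> n * t" "m * (t - T t w) \<le> m * t" "0 \<le> n * T t w" "0 \<le> m * (t - T t w)"
        using True assms by auto
      moreover have "\<bar>\<delta>\<bar> \<le> \<bar>\<delta>\<bar> * t" using t by (simp add: mult_le_cancel_left1)
      ultimately have "\<bar>D t (T t w)\<bar> \<le> n * t + m * t + \<bar>\<delta>\<bar> * t" unfolding D_def by linarith
      then show ?thesis by (simp add: A_def algebra_simps)
    qed
    from abs_line_mass_le[OF t lo S_lo S_hi this, where m = m and s = s and n = n and r = r] True
    have "sqrt t * \<bar>line_mass m s n r (S t (T t w)) (D t (T t w))\<bar> / (m + n) \<le>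
       P * normal_density 0 (sqrt hi) (D t (T t w) / sqrt t)"
      using mn by (simp add: P_def divide_right_mono)
    moreover have "D t (T t w) / sqrt t = w" using t by (simp add: DT)
    ultimately show ?thesis using True mn t by (simp add: F_def g_def abs_mult)
  next
    case False
    then show ?thesis using P by (auto simp: F_def g_def)
  qed
  have meas_g [measurable]: "g t \<in> borel_measurable borel" for t
    unfolding g_def S_def D_def by measurable
  have meas_F [measurable]: "F t \<in> borel_measurable borel" for t
    unfolding F_def T_def by measurable
  have int_w: "integrable lborel (\<lambda>w. P * normal_density 0 (sqrt hi) w)"
    using hi by simp
  have int_F: "integrable lborel (F t)" if "t \<ge> 1" for t
    by (rule Bochner_Integration.integrable_bound[OF int_w])
      (use bound[OF that] P in \<open>auto intro!: AE_I2 simp: abs_mult\<close>)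
  show ?integrable
    using eventually_ge_at_top[of 1]
  proof eventually_elim
    case (elim t)
    then have nz: "sqrt t / (m + n) \<noteq> 0" using mn by auto
    have "integrable lborel (\<lambda>w. inverse (sqrt t / (m + n)) * F t w)"
      using int_F[OF elim] by (intro integrable_mult_right)
    then have "integrable lborel (\<lambda>w. g t (T t w))"
      unfolding F_def mult.assoc[symmetric] left_inverse[OF nz] by simp
    then have "integrable lborel (g t)"
      unfolding T_def lborel_integrable_real_affine_iff[OF nz] .
    then show ?case
      by (simp add: set_integrable_def g_def[abs_def] S_def D_def)
  qed
  \<comment> \<open>The limit of \<open>T t w / t\<close> for every \<open>w\<close>, determined by
    \<open>n * \<theta> = m * (1 - \<theta>)\<close>; accordingly \<open>V\<close> is the limit of
    \<open>S t (T t w) / t\<close>.\<close>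
  define \<theta> where "\<theta> = m / (m + n)"
  have \<theta>: "0 < \<theta>" "\<theta> < 1" using assms mn by (auto simp: \<theta>_def)
  define V where "V = s\<^sup>2 * (1 - \<theta>) + r\<^sup>2 * \<theta>"
  have V: "V > 0" using assms \<theta> by (simp add: V_def add_pos_pos)
  have pointwise: "((\<lambda>t. F t w) \<longlongrightarrow> m * n / (m + n) * normal_density 0 (sqrt V) w) at_top" for w
  proof -
    have inv_t: "((\<lambda>t::real. k / t) \<longlongrightarrow> 0) at_top" for k
      by (intro tendsto_divide_0[OF tendsto_const] filterlim_at_top_imp_at_infinity filterlim_ident)
    have inv_sqrt: "((\<lambda>t::real. k / sqrt t) \<longlongrightarrow> 0) at_top" for k
      by (intro tendsto_divide_0[OF tendsto_const] filterlim_at_top_imp_at_infinity sqrt_at_top)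
    have "((\<lambda>t. \<theta> - (\<delta> / (m + n)) / t + (w / (m + n)) / sqrt t) \<longlongrightarrow> \<theta> - 0 + 0) at_top"
      by (intro tendsto_intros inv_t inv_sqrt)
    moreover have "eventually (\<lambda>t. \<theta> - (\<delta> / (m + n)) / t + (w / (m + n)) / sqrt t = T t w / t) at_top"
      using eventually_gt_at_top[of 0]
    proof eventually_elim
      case (elim t)
      have "m / q - \<delta> / q / t + w / q / sqrt t = ((m * t - \<delta>) / q + sqrt t / q * w) / t" if "q > 0" for q
        using elim that by (simp add: field_simps)
      with mn show ?case by (simp add: T_def \<theta>_def)
    qed
    ultimately have T_lim: "((\<lambda>t. T t w / t) \<longlongrightarrow> \<theta>) at_top"
      by (simp add: tendsto_cong)
    \<comment> \<open>As \<open>\<theta>\<close> is strictly between 0 and 1, the indicator in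
      \<open>g\<close> is eventually 1 for fixed \<open>w\<close>.\<close>
    have "eventually (\<lambda>t. 0 < T t w / t \<and> T t w / t < 1) at_top"
      using order_tendstoD[OF T_lim] \<theta> by (auto intro: eventually_conj)
    then have inside: "eventually (\<lambda>t. 0 < T t w \<and> T t w < t) at_top"
      using eventually_gt_at_top[of 0] by eventually_elim (auto simp: zero_less_divide_iff divide_less_eq)
    have "((\<lambda>t. s\<^sup>2 * (1 - T t w / t) + r\<^sup>2 * (T t w / t)) \<longlongrightarrow> V) at_top"
      unfolding V_def by (intro tendsto_intros T_lim)
    moreover have "eventually (\<lambda>t. s\<^sup>2 * (1 - T t w / t) + r\<^sup>2 * (T t w / t) = S t (T t w) / t) at_top"
      using eventually_gt_at_top[of 0] by eventually_elim (simp add: S_def field_simps)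
    ultimately have S_lim: "((\<lambda>t. S t (T t w) / t) \<longlongrightarrow> V) at_top"
      by (simp add: tendsto_cong)
    have nd_lim: "((\<lambda>t. normal_density 0 (sqrt (S t (T t w) / t)) w) \<longlongrightarrow> normal_density 0 (sqrt V) w) at_top"
      unfolding normal_density_def using V by (intro tendsto_intros S_lim) auto
    \<comment> \<open>The numerators \<open>w / sqrt t\<close> and
      \<open>s\<^sup>2 * r\<^sup>2 / t\<close> vanish in the limit, so only \<open>m * n\<close>
      survives in front of the Gaussian.\<close>
    have "((\<lambda>t. 1 / (m + n) * (((m + s\<^sup>2 * ((w / sqrt t) / (S t (T t w) / t))) *
        (n - r\<^sup>2 * ((w / sqrt t) / (S t (T t w) / t))) + s\<^sup>2 * r\<^sup>2 / t / (S t (T t w) / t))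
        * normal_density 0 (sqrt (S t (T t w) / t)) w)) \<longlongrightarrow>
        1 / (m + n) * (((m + s\<^sup>2 * (0 / V)) * (n - r\<^sup>2 * (0 / V)) + 0 / V) * normal_density 0 (sqrt V) w)) at_top"
      using V by (intro tendsto_mult tendsto_add tendsto_diff tendsto_divide tendsto_const S_lim nd_lim inv_t inv_sqrt) auto
    moreover have "eventually (\<lambda>t. 1 / (m + n) * (((m + s\<^sup>2 * ((w / sqrt t) / (S t (T t w) / t))) *
        (n - r\<^sup>2 * ((w / sqrt t) / (S t (T t w) / t))) + s\<^sup>2 * r\<^sup>2 / t / (S t (T t w) / t))
        * normal_density 0 (sqrt (S t (T t w) / t)) w) = F t w) at_top"
      using inside
    proof eventually_elim
      case (elim t)
      then have t: "t > 0" by linarith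
      with elim have "S t (T t w) > 0" using S_lo[of "T t w" t] mult_pos_pos[OF lo t] by linarith
      note line_mass_scale[OF t this, symmetric]
      then show ?case
        by (simp only: F_def g_def DT) (use elim in simp)
    qed
    ultimately show ?thesis by (simp add: tendsto_cong)
  qed
  have "((\<lambda>t. integral\<^sup>L lborel (F t)) \<longlongrightarrow>
      (\<integral>w. m * n / (m + n) * normal_density 0 (sqrt V) w \<partial>lborel)) at_top"
  proof (rule integral_dominated_convergence_at_top[where w = "\<lambda>w. P * normal_density 0 (sqrt hi) w"])
    show "\<forall>\<^sub>F t in at_top. AE w in lborel. norm (F t w) \<le> P * normal_density 0 (sqrt hi) w"
      using eventually_ge_at_top[of 1] by eventually_elim (use bound in auto)
  qed (use int_w pointwise in auto)
  moreover have "(\<integral>w. m * n / (m + n) * normal_density 0 (sqrt V) w \<partial>lborel) = m * n / (m + n)"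
    using V by simp
  moreover have "eventually (\<lambda>t. integral\<^sup>L lborel (F t) = (LBINT \<tau>:{0<..<t}. line_mass m s n r (S t \<tau>) (D t \<tau>))) at_top"
    using eventually_gt_at_top[of 0]
  proof eventually_elim
    case (elim t)
    then have pos: "sqrt t / (m + n) > 0" using mn by auto
    have "(LBINT \<tau>:{0<..<t}. line_mass m s n r (S t \<tau>) (D t \<tau>)) = integral\<^sup>L lborel (g t)"
      by (simp add: set_lebesgue_integral_def g_def[abs_def])
    also have "\<dots> = \<bar>sqrt t / (m + n)\<bar> *\<^sub>R (\<integral>w. g t (T t w) \<partial>lborel)"
      unfolding T_def using pos by (intro lborel_integral_real_affine) auto
    also have "\<dots> = integral\<^sup>L lborel (F t)"
      unfolding F_def[abs_def] abs_of_pos[OF pos] by simp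
    finally show ?case ..
  qed
  ultimately show ?limit
    unfolding S_def D_def by (simp only: tendsto_cong)
qed

section \<open>Limit of the double integral of hitting densities\<close>

text \<open>With the integrals exchanged, the slice at time \<open>\<tau>\<close> over
  \<open>b > 0\<close> is the whole-line value \<open>J\<close> minus the part \<open>R\<close> over
  \<open>b \<le> 0\<close>. \<open>J\<close> yields the limit and \<open>R\<close> contributes
  nothing.\<close>

lemma tendsto_integral_hitting_density:
  fixes m n s r c d :: real
  assumes "m > 0" "n > 0" "s > 0" "r > 0" "c \<ge> 0" "d \<ge> 0"
  shows "((\<lambda>t. LBINT b:{0<..}. LBINT \<tau>:{0<..<t}.
      hitting_density m s (t - \<tau>) (b + c) * hitting_density n r \<tau> (b + d)) \<longlongrightarrow> m * n / (m + n)) at_top"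
proof -
  define J where "J t \<tau> = line_mass m s n r (s\<^sup>2 * (t - \<tau>) + r\<^sup>2 * \<tau>) (n * \<tau> - m * (t - \<tau>) + (c - d))" for t \<tau>
  define Q where "Q t \<tau> b = hitting_density m s (t - \<tau>) (b + c) * hitting_density n r \<tau> (b + d)" for t \<tau> b
  define R where "R t \<tau> = (LBINT b:{..0}. Q t \<tau> b)" for t \<tau>
  define k where "k = min (m\<^sup>2 / (2 * s\<^sup>2)) (n\<^sup>2 / (2 * r\<^sup>2))"
  define C where "C = exp (m * c / s\<^sup>2) * exp (n * d / r\<^sup>2) * (r + s)"
  \<comment> \<open>Majorant of \<open>R\<close> for \<open>t \<ge> 2\<close>: singular at both ends
    of the interval, yet with integral of order \<open>exp (- (k * t)) * sqrt t\<close>.\<close>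
  define w where "w t \<tau> = C * exp (- (k * t)) *
    (indicator {0<..<t} \<tau> * (1 / sqrt (t - \<tau>)) + indicator {0<..<t} \<tau> * (1 / sqrt \<tau>))" for t \<tau>
  have k: "k > 0" using assms by (simp add: k_def)
  have C: "C \<ge> 0" using assms by (simp add: C_def)
  have int_Q: "has_bochner_integral lborel (Q t \<tau>) (J t \<tau>)" if "0 < \<tau>" "\<tau> < t" for t \<tau>
    using integral_hitting_density_line[of "t - \<tau>" \<tau> s r m c n d] that assms
    unfolding Q_def J_def by simp
  have w: "has_bochner_integral lborel (w t) (C * exp (- (k * t)) * (2 * sqrt t + 2 * sqrt t))"
    if t: "t > 0" for t
  proof -
    have 1: "has_bochner_integral lborel (\<lambda>\<tau>. indicator {0<..<t} \<tau> * (1 / sqrt \<tau>)) (2 * sqrt t)"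
      using has_bochner_integral_inverse_sqrt[OF t] by simp
    \<comment> \<open>Reflecting \<open>\<tau>\<close> to \<open>t - \<tau>\<close> moves the
      singularity to the other endpoint.\<close>
    have "has_bochner_integral lborel (\<lambda>\<tau>. indicator {0<..<t} (t + (- 1) * \<tau>) * (1 / sqrt (t + (- 1) * \<tau>)))
       (2 * sqrt t /\<^sub>R \<bar>- 1\<bar>)"
      using 1 by (subst lborel_has_bochner_integral_real_affine_iff[symmetric]) auto
    moreover have "indicator {0<..<t} (t + (- 1) * \<tau>) = (indicator {0<..<t} \<tau> :: real)" for \<tau>
      by (auto simp: indicator_def)
    ultimately have 2: "has_bochner_integral lborel (\<lambda>\<tau>. indicator {0<..<t} \<tau> * (1 / sqrt (t - \<tau>))) (2 * sqrt t)"
      by simp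
    show ?thesis
      unfolding w_def by (intro has_bochner_integral_mult_right has_bochner_integral_add 1 2)
  qed
  have R_le: "norm (indicator {0<..<t} \<tau> *\<^sub>R R t \<tau>) \<le> w t \<tau>" if "t \<ge> 2" for t \<tau>
  proof (cases "0 < \<tau> \<and> \<tau> < t")
    case True
    then have "\<bar>R t \<tau>\<bar> \<le> C * exp (- (k * (t - \<tau> + \<tau>))) * (1 / sqrt (t - \<tau>) + 1 / sqrt \<tau>)"
      unfolding R_def Q_def C_def using that assms by (intro abs_tail_mass_le_inverse_sqrt) (auto simp: k_def)
    with True show ?thesis by (simp add: w_def)
  next
    case False
    then show ?thesis by (auto simp: w_def)
  qed
  have R_meas: "(\<lambda>\<tau>. indicator {0<..<t} \<tau> *\<^sub>R R t \<tau>) \<in> borel_measurable lborel" for t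
    unfolding R_def set_lebesgue_integral_def Q_def by measurable
  have int_R: "integrable lborel (\<lambda>\<tau>. indicator {0<..<t} \<tau> *\<^sub>R R t \<tau>)" if t: "t \<ge> 2" for t
  proof (rule Bochner_Integration.integrable_bound[OF _ R_meas])
    show "integrable lborel (w t)" by (rule integrable.intros[OF w]) (use t in simp)
    show "AE \<tau> in lborel. norm (indicator {0<..<t} \<tau> *\<^sub>R R t \<tau>) \<le> norm (w t \<tau>)"
      using R_le[OF t] by (intro AE_I2) (metis abs_ge_self order_trans real_norm_def)
  qed
  have le_R: "\<bar>LBINT \<tau>:{0<..<t}. R t \<tau>\<bar> \<le> C * exp (- (k * t)) * (2 * sqrt t + 2 * sqrt t)" if t: "t \<ge> 2" for t
  proof -
    have "\<bar>LBINT \<tau>:{0<..<t}. R t \<tau>\<bar> \<le> integral\<^sup>L lborel (w t)"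
      unfolding set_lebesgue_integral_def
      using Bochner_Integration.integral_norm_bound_integral[OF int_R[OF t] integrable.intros[OF w] R_le[OF t]] t
      by simp
    also have "\<dots> = C * exp (- (k * t)) * (2 * sqrt t + 2 * sqrt t)"
      using w t by (intro has_bochner_integral_integral_eq) simp
    finally show ?thesis .
  qed
  have "((\<lambda>t. C * exp (- (k * t)) * (2 * sqrt t + 2 * sqrt t)) \<longlongrightarrow> 0) at_top"
    using k by real_asymp
  then have R_lim: "((\<lambda>t. LBINT \<tau>:{0<..<t}. R t \<tau>) \<longlongrightarrow> 0) at_top"
    by (rule Lim_null_comparison[rotated])
      (use eventually_ge_at_top[of 2] in \<open>eventually_elim, use le_R in auto\<close>)
  have J_lim: "((\<lambda>t. LBINT \<tau>:{0<..<t}. J t \<tau>) \<longlongrightarrow> m * n / (m + n)) at_top"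
    unfolding J_def using assms by (intro tendsto_integral_line_mass)
  have "((\<lambda>t. (LBINT \<tau>:{0<..<t}. J t \<tau>) - (LBINT \<tau>:{0<..<t}. R t \<tau>)) \<longlongrightarrow> m * n / (m + n) - 0) at_top"
    by (intro tendsto_diff J_lim R_lim)
  moreover have "eventually (\<lambda>t. set_integrable lborel {0<..<t} (J t)) at_top"
    unfolding J_def using assms by (intro set_integrable_line_mass)
  then have "eventually (\<lambda>t. (LBINT b:{0<..}. LBINT \<tau>:{0<..<t}. Q t \<tau> b) =
      (LBINT \<tau>:{0<..<t}. J t \<tau>) - (LBINT \<tau>:{0<..<t}. R t \<tau>)) at_top"
    using eventually_ge_at_top[of 2]
  proof eventually_elim
    case (elim t)
    define f where "f \<tau> b = indicator {0<..<t} \<tau> *\<^sub>R (indicator {0<..} b *\<^sub>R Q t \<tau> b)" for \<tau> b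
    \<comment> \<open>Because \<open>c\<close> and \<open>d\<close> are nonnegative, both factors
      are nonnegative on \<open>b > 0\<close>. The norm in Fubini's criterion then disappears, and
      integrability of \<open>J\<close> and \<open>R\<close> in \<open>\<tau>\<close>
      suffices.\<close>
    have f_nonneg: "f \<tau> b \<ge> 0" for \<tau> b
      using assms by (auto simp: f_def Q_def indicator_def intro!: mult_nonneg_nonneg hitting_density_nonneg)
    have f: "has_bochner_integral lborel (f \<tau>)
        (indicator {0<..<t} \<tau> *\<^sub>R J t \<tau> - indicator {0<..<t} \<tau> *\<^sub>R R t \<tau>)" for \<tau>
    proof (cases "0 < \<tau> \<and> \<tau> < t")
      case True
      then have Q: "has_bochner_integral lborel (Q t \<tau>) (J t \<tau>)" using int_Q by auto
      then have "has_bochner_integral lborel (\<lambda>b. indicator {..0} b *\<^sub>R Q t \<tau> b) (R t \<tau>)"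
        unfolding R_def set_lebesgue_integral_def
        by (intro has_bochner_integral_integrable integrable_mult_indicator integrable.intros) auto
      from has_bochner_integral_diff[OF Q this]
      have "has_bochner_integral lborel (\<lambda>b. Q t \<tau> b - indicator {..0} b *\<^sub>R Q t \<tau> b) (J t \<tau> - R t \<tau>)" .
      moreover have "(\<lambda>b. Q t \<tau> b - indicator {..0} b *\<^sub>R Q t \<tau> b) = f \<tau>"
        using True by (auto simp: f_def indicator_def)
      ultimately show ?thesis using True by simp
    next
      case False
      then have "f \<tau> = (\<lambda>_. 0)" "indicator {0<..<t} \<tau> = (0::real)" by (auto simp: f_def)
      then show ?thesis by (simp add: has_bochner_integral_zero)
    qed
    have f_int: "(\<integral>b. f \<tau> b \<partial>lborel) = indicator {0<..<t} \<tau> *\<^sub>R J t \<tau> - indicator {0<..<t} \<tau> *\<^sub>R R t \<tau>" for \<tau>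
      using f by (rule has_bochner_integral_integral_eq)
    have "integrable (lborel \<Otimes>\<^sub>M lborel) (case_prod f)"
    proof (rule lborel_pair.Fubini_integrable)
      show "case_prod f \<in> borel_measurable (lborel \<Otimes>\<^sub>M lborel)"
        unfolding f_def Q_def by measurable
      show "integrable lborel (\<lambda>\<tau>. \<integral>b. norm (case_prod f (\<tau>, b)) \<partial>lborel)"
        using f_nonneg f_int elim int_R by (simp add: set_integrable_def)
      show "AE \<tau> in lborel. integrable lborel (\<lambda>b. case_prod f (\<tau>, b))"
        using f by (auto intro: integrable.intros)
    qed
    then have "(\<integral>b. \<integral>\<tau>. f \<tau> b \<partial>lborel \<partial>lborel) = (\<integral>\<tau>. \<integral>b. f \<tau> b \<partial>lborel \<partial>lborel)"
      by (rule lborel_pair.Fubini_integral)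
    also have "\<dots> = (LBINT \<tau>:{0<..<t}. J t \<tau>) - (LBINT \<tau>:{0<..<t}. R t \<tau>)"
      unfolding f_int set_lebesgue_integral_def
      using elim int_R by (intro Bochner_Integration.integral_diff) (auto simp: set_integrable_def)
    also have "(\<integral>b. \<integral>\<tau>. f \<tau> b \<partial>lborel \<partial>lborel) = (LBINT b:{0<..}. LBINT \<tau>:{0<..<t}. Q t \<tau> b)"
      unfolding set_lebesgue_integral_def f_def
      by (simp add: mult.left_commute[of "indicator {0<..} _"] flip: Bochner_Integration.integral_mult_right_zero)
    finally show ?case .
  qed
  ultimately show ?thesis unfolding Q_def by (simp add: tendsto_cong)
qed

section \<open>Transfer to \<open>h\<close> and the vanishing Gaussian terms\<close>

lemma set_lebesgue_integral_cong_on: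
  assumes "\<And>x. x \<in> A \<Longrightarrow> f x = g x"
  shows "(LINT x:A|M. f x) = (LINT x:A|M. g x)"
  unfolding set_lebesgue_integral_def
  using assms by (auto intro!: Bochner_Integration.integral_cong simp: indicator_def)

text \<open>This is the shape of the same-side term, the density by the method of images of paths
  that have not reached \<open>a\<close>. The exponentials are at most 1 and
  \<open>exp (- \<gamma>)\<close>, while the prefactor decays like
  \<open>1 / sqrt t\<close>.\<close>

lemma tendsto_exp_diff_div_sqrt:
  assumes "s > 0"
  shows "((\<lambda>t. 1 / sqrt (2 * pi * t * s\<^sup>2) *
    (exp (- ((\<alpha> - \<mu> * t)\<^sup>2 / (2 * t * s\<^sup>2))) - exp (- ((\<beta> - \<mu> * t)\<^sup>2 / (2 * t * s\<^sup>2)) - \<gamma>))) \<longlongrightarrow> 0) at_top"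
proof (rule Lim_null_comparison)
  have "((\<lambda>t. 1 / sqrt (q * t) * C) \<longlongrightarrow> 0) at_top" if "q > 0" for q C :: real
    using that by real_asymp
  from this[of "2 * pi * s\<^sup>2"] assms
  show "((\<lambda>t. 1 / sqrt (2 * pi * s\<^sup>2 * t) * (1 + exp (- \<gamma>))) \<longlongrightarrow> 0) at_top"
    by simp
  show "\<forall>\<^sub>F t in at_top. norm (1 / sqrt (2 * pi * t * s\<^sup>2) *
    (exp (- ((\<alpha> - \<mu> * t)\<^sup>2 / (2 * t * s\<^sup>2))) - exp (- ((\<beta> - \<mu> * t)\<^sup>2 / (2 * t * s\<^sup>2)) - \<gamma>)))
      \<le> 1 / sqrt (2 * pi * s\<^sup>2 * t) * (1 + exp (- \<gamma>))"
    using eventually_gt_at_top[of 0]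
  proof eventually_elim
    case (elim t)
    let ?x = "exp (- ((\<alpha> - \<mu> * t)\<^sup>2 / (2 * t * s\<^sup>2)))"
    let ?y = "exp (- ((\<beta> - \<mu> * t)\<^sup>2 / (2 * t * s\<^sup>2)) - \<gamma>)"
    have "?x \<le> 1" "?y \<le> exp (- \<gamma>)" using elim by auto
    moreover have "0 < ?x" "0 < ?y" by simp_all
    ultimately have "\<bar>?x - ?y\<bar> \<le> 1 + exp (- \<gamma>)" by linarith
    then have "1 / sqrt (2 * pi * t * s\<^sup>2) * \<bar>?x - ?y\<bar> \<le> 1 / sqrt (2 * pi * t * s\<^sup>2) * (1 + exp (- \<gamma>))"
      using elim by (intro mult_left_mono) auto
    moreover have "norm (1 / sqrt (2 * pi * t * s\<^sup>2) * (?x - ?y)) = 1 / sqrt (2 * pi * t * s\<^sup>2) * \<bar>?x - ?y\<bar>"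
      using elim by (simp add: abs_mult del: real_sqrt_mult)
    moreover have "2 * pi * s\<^sup>2 * t = 2 * pi * t * s\<^sup>2" by simp
    ultimately show ?case by metis
  qed
qed

text \<open>The weight contains \<open>b\<close> where the drift reversal needs
  \<open>b + c\<close>; the discrepancy is the constant in front of the limit. The second passage,
  with \<open>n < 0\<close>, already drifts toward its barrier.\<close>

lemma tendsto_integral_h:
  assumes "m > 0" "n < 0" "s > 0" "r > 0" "c \<ge> 0" "d \<ge> 0"
  shows "((\<lambda>t. LBINT b:{0<..}. LBINT \<tau>:{0<..<t}. exp (2 * m * b / s\<^sup>2)
      * h (t - \<tau>) ((b + c) / s) (m / s) * h \<tau> ((b + d) / r) (n / r))
    \<longlongrightarrow> exp (- (2 * m * c / s\<^sup>2)) * (- m * n / (m - n))) at_top"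
proof -
  have "(LBINT b:{0<..}. LBINT \<tau>:{0<..<t}. exp (2 * m * b / s\<^sup>2)
      * h (t - \<tau>) ((b + c) / s) (m / s) * h \<tau> ((b + d) / r) (n / r)) =
    (LBINT b:{0<..}. LBINT \<tau>:{0<..<t}. exp (- (2 * m * c / s\<^sup>2)) *
      (hitting_density m s (t - \<tau>) (b + c) * hitting_density (- n) r \<tau> (b + d)))" for t
  proof (intro set_lebesgue_integral_cong_on)
    fix b \<tau> :: real assume "b \<in> {0<..}" "\<tau> \<in> {0<..<t}"
    then have *: "exp (2 * m * (b + c) / s\<^sup>2) * h (t - \<tau>) ((b + c) / s) (m / s) = hitting_density m s (t - \<tau>) (b + c)"
        "h \<tau> ((b + d) / r) (- (- n) / r) = hitting_density (- n) r \<tau> (b + d)"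
      using assms by (intro exp_h_eq_hitting_density h_eq_hitting_density; simp)+
    have "exp (2 * m * b / s\<^sup>2) = exp (- (2 * m * c / s\<^sup>2)) * exp (2 * m * (b + c) / s\<^sup>2)"
      by (simp add: mult_exp_exp distrib_left add_divide_distrib)
    then show "exp (2 * m * b / s\<^sup>2) * h (t - \<tau>) ((b + c) / s) (m / s) * h \<tau> ((b + d) / r) (n / r) =
      exp (- (2 * m * c / s\<^sup>2)) * (hitting_density m s (t - \<tau>) (b + c) * hitting_density (- n) r \<tau> (b + d))"
      unfolding *[symmetric] by simp
  qed
  moreover have "((\<lambda>t. exp (- (2 * m * c / s\<^sup>2)) * (LBINT b:{0<..}. LBINT \<tau>:{0<..<t}.
      hitting_density m s (t - \<tau>) (b + c) * hitting_density (- n) r \<tau> (b + d)))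
    \<longlongrightarrow> exp (- (2 * m * c / s\<^sup>2)) * (m * (- n) / (m + (- n)))) at_top"
    using assms by (intro tendsto_mult_left tendsto_integral_hitting_density) auto
  ultimately show ?thesis by simp
qed

text \<open>\<open>h\<close> is invariant under a simultaneous sign change of position and drift, so
  replacing \<open>b\<close> by \<open>- b\<close> leads back to the positive half line with
  \<open>m\<close>, \<open>n\<close>, \<open>c\<close>, \<open>d\<close> negated.\<close>

lemma tendsto_integral_h_reflected:
  assumes "m < 0" "n > 0" "s > 0" "r > 0" "c \<le> 0" "d \<le> 0"
  shows "((\<lambda>t. LBINT b:{..<0}. LBINT \<tau>:{0<..<t}. exp (2 * m * b / s\<^sup>2)
      * h (t - \<tau>) ((b + c) / s) (m / s) * h \<tau> ((b + d) / r) (n / r))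
    \<longlongrightarrow> exp (- (2 * m * c / s\<^sup>2)) * (- m * n / (n - m))) at_top"
proof -
  have "(LBINT b:{..<0}. LBINT \<tau>:{0<..<t}. exp (2 * m * b / s\<^sup>2)
      * h (t - \<tau>) ((b + c) / s) (m / s) * h \<tau> ((b + d) / r) (n / r)) =
    (LBINT b:{0<..}. LBINT \<tau>:{0<..<t}. exp (2 * (- m) * b / s\<^sup>2)
      * h (t - \<tau>) ((b + - c) / s) (- m / s) * h \<tau> ((b + - d) / r) (- n / r))" for t
  proof -
    have neg: "h u ((- b + e) / q) (k / q) = h u ((b + - e) / q) (- k / q)" for u b e q k
    proof -
      have 1: "- ((b + - e) / q) = (- b + e) / q" unfolding minus_divide_left by simp
      have 2: "- (- k / q) = k / q" by simp
      show ?thesis using h_uminus[of u "(b + - e) / q" "- k / q"] unfolding 1 2 .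
    qed
    have reflect: "{b::real. - b \<in> {..<0}} = {0<..}" by auto
    show ?thesis
      by (subst set_integral_reflect) (simp only: neg reflect, simp)
  qed
  then show ?thesis
    using tendsto_integral_h[of "- m" "- n" s r "- c" "- d"] assms by simp
qed

section \<open>The four positions of \<open>x\<close> and \<open>z\<close> relative to
  \<open>a\<close>\<close>

theorem proposition4p1:
  fixes a \<mu>1 \<mu>2 \<sigma>1 \<sigma>2 :: real
    and M :: "'w measure" and B :: "real \<Rightarrow> 'w \<Rightarrow> real"
    and X :: "real \<Rightarrow> real \<Rightarrow> 'w \<Rightarrow> real"
    and p :: "real \<Rightarrow> real \<Rightarrow> real \<Rightarrow> real"
  assumes "\<mu>1 > 0" and "\<mu>2 < 0" and "\<sigma>1 > 0" and "\<sigma>2 > 0"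
    and "prob_space M" and "complete_measure M" and "brownian_motion M B"
    and solution: "\<And>x. strong_solution M B (two_valued a \<mu>1 \<mu>2) (two_valued a \<sigma>1 \<sigma>2) x (X x)"
    and transition_density:
      "\<And>t x. t > 0 \<Longrightarrow> distributed M lborel (X x t) (\<lambda>z. ennreal (p t x z))"
    and version: "\<And>t x z. t > 0 \<Longrightarrow> p t x z = density_version a \<mu>1 \<mu>2 \<sigma>1 \<sigma>2 t x z"
  shows "\<forall>x z. ((\<lambda>t. p t x z) \<longlongrightarrow>
      (if z \<ge> a
       then (- \<mu>1 * \<mu>2) / (\<mu>1 - \<mu>2) * (2 / \<sigma>2\<^sup>2) * exp (2 * \<mu>2 * (z - a) / \<sigma>2\<^sup>2)
       else (- \<mu>1 * \<mu>2) / (\<mu>1 - \<mu>2) * (2 / \<sigma>1\<^sup>2) * exp (2 * \<mu>1 * (z - a) / \<sigma>1\<^sup>2))) at_top"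
proof (intro allI)
  fix x z
  note pos = \<open>\<mu>1 > 0\<close> \<open>\<mu>2 < 0\<close> \<open>\<sigma>1 > 0\<close> \<open>\<sigma>2 > 0\<close>
  \<comment> \<open>Equal to \<open>1 / (1 / \<mu>1 + 1 / (- \<mu>2))\<close>, the renewal constant
    for the speeds \<open>\<mu>1\<close> and \<open>- \<mu>2\<close>.\<close>
  let ?c = "- \<mu>1 * \<mu>2 / (\<mu>1 - \<mu>2)"
  have "((\<lambda>t. density_version a \<mu>1 \<mu>2 \<sigma>1 \<sigma>2 t x z) \<longlongrightarrow>
      (if z \<ge> a then ?c * (2 / \<sigma>2\<^sup>2) * exp (2 * \<mu>2 * (z - a) / \<sigma>2\<^sup>2)
       else ?c * (2 / \<sigma>1\<^sup>2) * exp (2 * \<mu>1 * (z - a) / \<sigma>1\<^sup>2))) at_top"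
    (is "(_ \<longlongrightarrow> ?L) at_top")
  proof (cases "x \<ge> a"; cases "z \<ge> a")
    assume xz: "x \<ge> a" "z \<ge> a"
    \<comment> \<open>Same side: \<open>c = 0\<close>, and \<open>d\<close> is the sum of the
      distances of \<open>x\<close> and \<open>z\<close> from \<open>a\<close>. The profile in
      \<open>z\<close> is an explicit weight that leaves the integrals.\<close>
    have lim: "((\<lambda>t. 2 / \<sigma>2\<^sup>2 * (exp (2 * \<mu>2 * (z - a) / \<sigma>2\<^sup>2) * (LBINT b:{0<..}. LBINT \<tau>:{0<..<t}.
        exp (2 * \<mu>1 * b / \<sigma>1\<^sup>2) * h (t - \<tau>) ((b + 0) / \<sigma>1) (\<mu>1 / \<sigma>1)
          * h \<tau> ((b + (z + x - 2 * a)) / \<sigma>2) (\<mu>2 / \<sigma>2)))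
       + 1 / sqrt (2 * pi * t * \<sigma>2\<^sup>2) *
           (exp (- ((z - x - \<mu>2 * t)\<^sup>2 / (2 * t * \<sigma>2\<^sup>2)))
            - exp (- ((z + x - 2 * a - \<mu>2 * t)\<^sup>2 / (2 * t * \<sigma>2\<^sup>2)) - 2 * \<mu>2 * (x - a) / \<sigma>2\<^sup>2)))
      \<longlongrightarrow> 2 / \<sigma>2\<^sup>2 * (exp (2 * \<mu>2 * (z - a) / \<sigma>2\<^sup>2) * (exp (- (2 * \<mu>1 * 0 / \<sigma>1\<^sup>2)) * ?c)) + 0) at_top"
      using pos xz by (intro tendsto_add tendsto_mult_left tendsto_integral_h tendsto_exp_diff_div_sqrt) auto
    have "b + 0 = b" "b + (z + x - 2 * a) = z + x - 2 * a + b" for b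
      by simp_all
    note lim = lim[unfolded this]
    have eq: "?L = 2 / \<sigma>2\<^sup>2 * (exp (2 * \<mu>2 * (z - a) / \<sigma>2\<^sup>2) *
        (exp (- (2 * \<mu>1 * 0 / \<sigma>1\<^sup>2)) * ?c))"
      using xz by (simp add: mult_ac)
    have "(x \<ge> a) = True" "(z \<ge> a) = True" "(z < a) = False"
      using xz by auto
    then show ?thesis
      unfolding eq using lim
      by (simp only: density_version_def if_True if_False mult.assoc set_integral_mult_right)
  next
    assume xz: "x \<ge> a" "\<not> z \<ge> a"
    \<comment> \<open>Opposite sides: \<open>c = a - z\<close>, and the profile in \<open>z\<close>
      is the constant left over by the drift reversal.\<close>
    have lim: "((\<lambda>t. 2 / \<sigma>1\<^sup>2 * (LBINT b:{0<..}. LBINT \<tau>:{0<..<t}.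
        exp (2 * \<mu>1 * b / \<sigma>1\<^sup>2) * h (t - \<tau>) ((b + (a - z)) / \<sigma>1) (\<mu>1 / \<sigma>1)
          * h \<tau> ((b + (x - a)) / \<sigma>2) (\<mu>2 / \<sigma>2)))
      \<longlongrightarrow> 2 / \<sigma>1\<^sup>2 * (exp (- (2 * \<mu>1 * (a - z) / \<sigma>1\<^sup>2)) * ?c)) at_top"
      using pos xz by (intro tendsto_mult_left tendsto_integral_h) auto
    have "b + (a - z) = b - z + a" "b + (x - a) = x - a + b" for b
      by simp_all
    note lim = lim[unfolded this]
    have *: "- (2 * \<mu>1 * (a - z) / \<sigma>1\<^sup>2) = 2 * \<mu>1 * (z - a) / \<sigma>1\<^sup>2"
      unfolding minus_divide_left mult_minus_right[symmetric] by simp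
    have eq: "?L = 2 / \<sigma>1\<^sup>2 * (exp (- (2 * \<mu>1 * (a - z) / \<sigma>1\<^sup>2)) * ?c)"
      unfolding * using xz by (simp add: mult_ac)
    have "(x \<ge> a) = True" "(z \<ge> a) = False" "(z < a) = True"
      using xz by auto
    then show ?thesis
      unfolding eq using lim
      by (simp only: density_version_def if_True if_False mult.assoc)
  next
    assume xz: "\<not> x \<ge> a" "z \<ge> a"
    \<comment> \<open>The reflected limit with the indices 1 and 2 exchanged;
      \<open>c = a - z\<close> and \<open>d = x - a\<close> are now at most 0.\<close>
    have lim: "((\<lambda>t. 2 / \<sigma>2\<^sup>2 * (LBINT b:{..<0}. LBINT \<tau>:{0<..<t}.
        exp (2 * \<mu>2 * b / \<sigma>2\<^sup>2) * h (t - \<tau>) ((b + (a - z)) / \<sigma>2) (\<mu>2 / \<sigma>2)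
          * h \<tau> ((b + (x - a)) / \<sigma>1) (\<mu>1 / \<sigma>1)))
      \<longlongrightarrow> 2 / \<sigma>2\<^sup>2 * (exp (- (2 * \<mu>2 * (a - z) / \<sigma>2\<^sup>2)) * (- \<mu>2 * \<mu>1 / (\<mu>1 - \<mu>2)))) at_top"
      using pos xz by (intro tendsto_mult_left tendsto_integral_h_reflected) auto
    have "b + (a - z) = b - z + a" "b + (x - a) = x - a + b" for b
      by simp_all
    note lim = lim[unfolded this]
    have *: "- (2 * \<mu>2 * (a - z) / \<sigma>2\<^sup>2) = 2 * \<mu>2 * (z - a) / \<sigma>2\<^sup>2"
      unfolding minus_divide_left mult_minus_right[symmetric] by simp
    have eq: "?L = 2 / \<sigma>2\<^sup>2 * (exp (- (2 * \<mu>2 * (a - z) / \<sigma>2\<^sup>2)) * (- \<mu>2 * \<mu>1 / (\<mu>1 - \<mu>2)))"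
      unfolding * using xz by (simp add: mult_ac)
    have "(x \<ge> a) = False" "(z \<ge> a) = True" "(z < a) = False"
      using xz by auto
    then show ?thesis
      unfolding eq using lim
      by (simp only: density_version_def if_True if_False mult.assoc)
  next
    assume xz: "\<not> x \<ge> a" "\<not> z \<ge> a"
    \<comment> \<open>Mirror image of the case where both points are at or above \<open>a\<close>;
      here \<open>d = z + x - 2 * a\<close> is negative.\<close>
    have lim: "((\<lambda>t. 2 / \<sigma>1\<^sup>2 * (exp (2 * \<mu>1 * (z - a) / \<sigma>1\<^sup>2) * (LBINT b:{..<0}. LBINT \<tau>:{0<..<t}.
        exp (2 * \<mu>2 * b / \<sigma>2\<^sup>2) * h (t - \<tau>) ((b + 0) / \<sigma>2) (\<mu>2 / \<sigma>2)
          * h \<tau> ((b + (z + x - 2 * a)) / \<sigma>1) (\<mu>1 / \<sigma>1)))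
       + 1 / sqrt (2 * pi * t * \<sigma>1\<^sup>2) *
           (exp (- ((z - x - \<mu>1 * t)\<^sup>2 / (2 * t * \<sigma>1\<^sup>2)))
            - exp (- ((z + x - 2 * a - \<mu>1 * t)\<^sup>2 / (2 * t * \<sigma>1\<^sup>2)) - 2 * \<mu>1 * (x - a) / \<sigma>1\<^sup>2)))
      \<longlongrightarrow> 2 / \<sigma>1\<^sup>2 * (exp (2 * \<mu>1 * (z - a) / \<sigma>1\<^sup>2) *
          (exp (- (2 * \<mu>2 * 0 / \<sigma>2\<^sup>2)) * (- \<mu>2 * \<mu>1 / (\<mu>1 - \<mu>2)))) + 0) at_top"
      using pos xz by (intro tendsto_add tendsto_mult_left tendsto_integral_h_reflected tendsto_exp_diff_div_sqrt) auto
    have "b + 0 = b" "b + (z + x - 2 * a) = z + x - 2 * a + b" for b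
      by simp_all
    note lim = lim[unfolded this]
    have eq: "?L = 2 / \<sigma>1\<^sup>2 * (exp (2 * \<mu>1 * (z - a) / \<sigma>1\<^sup>2) *
        (exp (- (2 * \<mu>2 * 0 / \<sigma>2\<^sup>2)) * (- \<mu>2 * \<mu>1 / (\<mu>1 - \<mu>2))))"
      using xz by (simp add: mult_ac)
    have "(x \<ge> a) = False" "(z \<ge> a) = False" "(z < a) = True"
      using xz by auto
    then show ?thesis
      unfolding eq using lim
      by (simp only: density_version_def if_True if_False mult.assoc set_integral_mult_right)
  qed
  moreover have "\<forall>\<^sub>F t in at_top. p t x z = density_version a \<mu>1 \<mu>2 \<sigma>1 \<sigma>2 t x z"
    using eventually_gt_at_top[of 0] by eventually_elim (rule version)
  ultimately show "((\<lambda>t. p t x z) \<longlongrightarrow>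
      (if z \<ge> a
       then (- \<mu>1 * \<mu>2) / (\<mu>1 - \<mu>2) * (2 / \<sigma>2\<^sup>2) * exp (2 * \<mu>2 * (z - a) / \<sigma>2\<^sup>2)
       else (- \<mu>1 * \<mu>2) / (\<mu>1 - \<mu>2) * (2 / \<sigma>1\<^sup>2) * exp (2 * \<mu>1 * (z - a) / \<sigma>1\<^sup>2))) at_top"
    by (simp only: tendsto_cong)
qed

end
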